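(* Let $X_1,\dots,X_n$ be i.i.d. $N_p(\theta,\Sigma)$ with $\Sigma$ an unknown arbitrary positive definite matrix. For the problem of testing $H_0:\theta=0$ against $H_1:\theta\in\mathcal{C}\setminus\{0\}$, where $\mathcal{C}$ is either the positive orthant $\mathcal{O}_p^+=\{\theta\in\mathbb{R}^p:\theta\ge0\}$ or the halfspace $\mathcal{H}_p^*=\{\theta\in\mathbb{R}^p:\theta_p\ge0\}$, the union-intersection test (UIT) of size $\alpha$ is not a Bayes test.
   Context: Setting: $n>p$; $\mathcal{M}$ denotes the set of all $p\times p$ positive definite matrices and $\Sigma$ ranges over $\mathcal{M}$. Put $\bar X_n=n^{-1}\sum_{i=1}^n X_i$ and $S_n=(n-1)^{-1}\sum_{i=1}^n(X_i-\bar X_n)(X_i-\bar X_n)'$. Notation: $P=\{1,\dots,p\}$; for $\emptyset\subseteq a\subseteq P$, $a'$ is the complement of $a$ in $P$, and $\bar X_n$, $S_n$ are partitioned into $\bar X_{na},\bar X_{na'}$ and blocks $S_{naa},S_{naa'},S_{na'a},S_{na'a'}$. Define $$\bar X_{na:a'}=\bar X_{na}-S_{naa'}S_{na'a'}^{-1}\bar X_{na'},\qquad S_{naa:a'}=S_{naa}-S_{naa'}S_{na'a'}^{-1}S_{na'a},$$ (when $a=P$ these are $\bar X_n$ and $S_n$; when $a=\emptyset$ quadratic forms indexed by $a$ are $0$), and $I_{na}=1\{\bar X_{na:a'}>0,\ S_{na'a'}^{-1}\bar X_{na'}\le0\}$, inequalities being coordinatewise. UIT statistics: for $\mathcal{C}=\mathcal{O}_p^+$,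 $$U_n=\sum_{\emptyset\subseteq a\subseteq P} n\bar X_{na:a'}'S_{naa:a'}^{-1}\bar X_{na:a'}\,I_{na};$$ for $\mathcal{C}=\mathcal{H}_p^*$, with $P_1=P\setminus\{p\}$, $$U_n^*=n\bar X_n'S_n^{-1}\bar X_n\,1\{\bar X_{np}>0\}+n\bar X_{nP_1:p}'S_{nP_1P_1:p}^{-1}\bar X_{nP_1:p}\,1\{\bar X_{np}\le0\}.$$ The UIT of size $\alpha$ accepts $H_0$ when the statistic is $\le u_\alpha$, where $u_\alpha>0$ is such that the supremum over $\Sigma\in\mathcal{M}$ of the rejection probability at $\theta=0$ equals $\alpha\in(0,1)$. Bayes test: a test is a Bayes test if there are a probability measure $G$ on $\{(\theta,\Sigma):\theta\in\mathcal{C}\setminus\{0\},\Sigma\in\mathcal{M}\}$, a probability measure $G_0$ on $\{(0,\Sigma):\Sigma\in\mathcal{M}\}$ and a constant $c$ such that, up to a Lebesgue-null set of sample points, it rejects $H_0$ exactly when $$\frac{\int f(X_1,\dots,X_n\mid\theta,\Sigma)\,dG(\theta,\Sigma)}{\int f(X_1,\dots,X_n\mid0,\Sigma)\,dG_0(\Sigma)}\ge c,$$ where $f$ is the joint normal density.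
   Formalization: The formal statement assumes p ≥ 2, since for p = 1 the UIT is the one-sided t-test, which is a Bayes test for suitable proper priors (θ/σ fixed, heavy-tailed prior on log σ). *)

theory Defs
  imports "HOL-Probability.Probability"
begin

text \<open>
  The coordinate set \<open>P = {1,\<dots>,p}\<close> is a finite linearly ordered type \<open>'p\<close>, whose greatest element
  \<open>Max UNIV\<close> is the coordinate \<open>p\<close>; the observations are indexed by a finite type \<open>'n\<close>. A sample
  \<open>X :: real^'p^'n\<close> has the observations \<open>X $ k :: real^'p\<close>.
\<close>

definition pos_def_matrices :: "(real^'p^'p) set" where
  "pos_def_matrices = {A. transpose A = A \<and> (\<forall>x. x \<noteq> 0 \<longrightarrow> 0 < x \<bullet> (A *v x))}"

definition orthant :: "(real^'p) set" where
  "orthant = {\<theta>. \<forall>i. 0 \<le> \<theta> $ i}"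

definition halfspace :: "(real^('p::{finite,linorder})) set" where
  "halfspace = {\<theta>. 0 \<le> \<theta> $ Max UNIV}"


subsection \<open>The normal model\<close>

definition mvn_density :: "real^'p \<Rightarrow> real^'p^'p \<Rightarrow> real^'p \<Rightarrow> real" where
  "mvn_density \<theta> \<Sigma> x =
     exp (- ((x - \<theta>) \<bullet> (matrix_inv \<Sigma> *v (x - \<theta>))) / 2) / sqrt ((2 * pi) ^ CARD('p) * det \<Sigma>)"

definition joint_density :: "real^'p \<Rightarrow> real^'p^'p \<Rightarrow> real^'p^'n \<Rightarrow> real" where
  "joint_density \<theta> \<Sigma> X = (\<Prod>k\<in>UNIV. mvn_density \<theta> \<Sigma> (X $ k))"

definition sample_law :: "real^'p \<Rightarrow> real^'p^'p \<Rightarrow> (real^'p^'n) measure" where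
  "sample_law \<theta> \<Sigma> = density lborel (\<lambda>X. ennreal (joint_density \<theta> \<Sigma> X))"


subsection \<open>Sample mean, sample covariance and their partitions\<close>

definition sample_mean :: "real^'p^'n \<Rightarrow> real^'p" where
  "sample_mean X = (1 / real CARD('n)) *\<^sub>R (\<Sum>k\<in>UNIV. X $ k)"

definition sample_cov :: "real^'p^'n \<Rightarrow> real^'p^'p" where
  "sample_cov X = (\<chi> i j. (1 / (real CARD('n) - 1)) *
     (\<Sum>k\<in>UNIV. (X $ k - sample_mean X) $ i * (X $ k - sample_mean X) $ j))"

text \<open>
  Subvectors and blocks indexed by subsets of \<open>P\<close> are kept in the full index range and padded with
  zeros, so that \<open>*v\<close>, \<open>**\<close> and \<open>\<bullet>\<close> act on them as on the blocks themselves.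
\<close>

definition subvec :: "'p set \<Rightarrow> real^'p \<Rightarrow> real^'p" where
  "subvec a x = (\<chi> i. if i \<in> a then x $ i else 0)"

definition block :: "'p set \<Rightarrow> 'p set \<Rightarrow> real^'p^'p \<Rightarrow> real^'p^'p" where
  "block a b A = (\<chi> i j. if i \<in> a \<and> j \<in> b then A $ i $ j else 0)"

text \<open>
  The zero-padded inverse of the block of \<open>A\<close> on \<open>a \<times> a\<close>: fill up that block with an identity block
  on the complement, invert, and cut the identity block off again.
\<close>

definition block_inv :: "'p set \<Rightarrow> real^'p^'p \<Rightarrow> real^'p^'p" where
  "block_inv a A = block a a (matrix_inv (block a a A + block (- a) (- a) (mat 1)))"

lemma block_inv_unique:
  fixes A B :: "real^'p^'p"
  assumes supp: "block a a B = B"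
    and AB: "block a a A ** B = block a a (mat 1)"
    and BA: "B ** block a a A = block a a (mat 1)"
  shows "block_inv a A = B"
proof -
  let ?E = "block (- a) (- a) (mat 1) :: real^'p^'p"
  have rd: "(K + L) ** M = K ** M + L ** M" for K L M :: "real^'p^'p"
    by (simp add: vec_eq_iff matrix_matrix_mult_def distrib_right sum.distrib)
  have AE: "block a a M ** ?E = 0" and EA: "?E ** block a a M = 0" for M :: "real^'p^'p"
    by (auto simp: vec_eq_iff matrix_matrix_mult_def block_def intro!: sum.neutral)
  have one: "block a a (mat 1) + ?E = mat 1"
    by (auto simp: vec_eq_iff block_def mat_def)
  have EE: "?E ** ?E = ?E"
  proof -
    have "?E = ?E ** (block a a (mat 1) + ?E)" by (simp only: one matrix_mul_rid)
    also have "\<dots> = ?E ** ?E" by (simp only: matrix_add_ldistrib EA add_0_left)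
    finally show ?thesis by (rule sym)
  qed
  have BE: "B ** ?E = 0" and EB: "?E ** B = 0"
    using AE[of B] EA[of B] by (simp_all only: supp)
  have "(block a a A + ?E) ** (B + ?E) = mat 1" "(B + ?E) ** (block a a A + ?E) = mat 1"
    by (simp_all only: matrix_add_ldistrib rd AE EA BE EB EE AB BA add_0_left add_0_right one)
  then have "matrix_inv (block a a A + ?E) = B + ?E"
    (is "matrix_inv ?M = ?N")
  proof -
    assume MN: "?M ** ?N = mat 1" and NM: "?N ** ?M = mat 1"
    have "?M ** matrix_inv ?M = mat 1 \<and> matrix_inv ?M ** ?M = mat 1"
      unfolding matrix_inv_def by (rule someI[of _ ?N]) (simp add: MN NM)
    then have "matrix_inv ?M = matrix_inv ?M ** (?M ** ?N)" and "matrix_inv ?M ** ?M = mat 1"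
      by (simp_all add: MN)
    then show ?thesis by (simp add: matrix_mul_assoc)
  qed
  moreover have "block a a (B + ?E) = B"
  proof -
    have "block a a (B + ?E) = block a a B" by (auto simp: vec_eq_iff block_def)
    then show ?thesis using supp by simp
  qed
  ultimately show ?thesis by (simp add: block_inv_def)
qed

text \<open>\<open>cond_mean a X\<close> and \<open>cond_cov a X\<close> are the vector and the matrix with index \<open>a:a'\<close>.\<close>

definition cond_mean :: "'p set \<Rightarrow> real^'p^'n \<Rightarrow> real^'p" where
  "cond_mean a X = subvec a (sample_mean X) -
     block a (- a) (sample_cov X) *v (block_inv (- a) (sample_cov X) *v subvec (- a) (sample_mean X))"

definition cond_cov :: "'p set \<Rightarrow> real^'p^'n \<Rightarrow> real^'p^'p" where
  "cond_cov a X = block a a (sample_cov X) -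
     block a (- a) (sample_cov X) ** block_inv (- a) (sample_cov X) ** block (- a) a (sample_cov X)"

definition cond_quad :: "'p set \<Rightarrow> real^'p^'n \<Rightarrow> real" where
  "cond_quad a X =
     real CARD('n) * (cond_mean a X \<bullet> (block_inv a (cond_cov a X) *v cond_mean a X))"

definition cone_event :: "'p set \<Rightarrow> real^'p^'n \<Rightarrow> bool" where
  "cone_event a X \<longleftrightarrow> (\<forall>i\<in>a. 0 < cond_mean a X $ i) \<and>
     (\<forall>i\<in>- a. (block_inv (- a) (sample_cov X) *v subvec (- a) (sample_mean X)) $ i \<le> 0)"


subsection \<open>The union-intersection tests\<close>

definition uit_orthant :: "real^'p^'n \<Rightarrow> real" where
  "uit_orthant X = (\<Sum>a\<in>Pow UNIV. cond_quad a X * of_bool (cone_event a X))"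

definition uit_halfspace :: "real^('p::{finite,linorder})^'n \<Rightarrow> real" where
  "uit_halfspace X =
     real CARD('n) * (sample_mean X \<bullet> (matrix_inv (sample_cov X) *v sample_mean X))
       * of_bool (0 < sample_mean X $ Max UNIV)
     + cond_quad (UNIV - {Max UNIV}) X * of_bool (sample_mean X $ Max UNIV \<le> 0)"

text \<open>A (nonrandomized) test is given by its rejection region.\<close>

definition has_size :: "(real^'p^'n) set \<Rightarrow> real \<Rightarrow> bool" where
  "has_size R \<alpha> \<longleftrightarrow> (SUP \<Sigma>\<in>pos_def_matrices. measure (sample_law 0 \<Sigma>) R) = \<alpha>"


subsection \<open>Bayes tests\<close>

definition prior_on :: "((real^'p) \<times> (real^'p^'p)) set \<Rightarrow> ((real^'p) \<times> (real^'p^'p)) measure \<Rightarrow> bool" where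
  "prior_on \<Omega> G \<longleftrightarrow> prob_space G \<and> space G = \<Omega> \<and> sets G = sets (restrict_space borel \<Omega>)"

text \<open>
  For \<open>'n\<close> larger than \<open>'p\<close> the two integrals below are finite and positive for almost every \<open>X\<close>,
  because the likelihood is bounded in \<open>(\<theta>, \<Sigma>)\<close> whenever the sample covariance is positive definite.
\<close>

definition bayes_ratio ::
  "((real^'p) \<times> (real^'p^'p)) measure \<Rightarrow> ((real^'p) \<times> (real^'p^'p)) measure \<Rightarrow> real^'p^'n \<Rightarrow> real" where
  "bayes_ratio G G0 X =
     (\<integral>(\<theta>, \<Sigma>). joint_density \<theta> \<Sigma> X \<partial>G) / (\<integral>(\<theta>, \<Sigma>). joint_density \<theta> \<Sigma> X \<partial>G0)"

definition bayes_test :: "(real^'p) set \<Rightarrow> (real^'p^'n) set \<Rightarrow> bool" where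
  "bayes_test C R \<longleftrightarrow> (\<exists>G G0 (c::real).
     prior_on ((C - {0}) \<times> pos_def_matrices) G \<and>
     prior_on ({0} \<times> pos_def_matrices) G0 \<and>
     (AE X in lborel. X \<in> R \<longleftrightarrow> bayes_ratio G G0 X \<ge> c))"

text \<open>
  For \<open>p = 1\<close> both cones are \<open>[0,\<infinity>)\<close> and the UIT is the one-sided t-test, which \<^emph>\<open>is\<close> a Bayes test for
  suitable proper priors (\<open>\<theta> / \<sigma>\<close> fixed and a heavy-tailed prior on \<open>log \<sigma>\<close>). Statements that a UIT is
  not Bayes therefore need \<open>p \<ge> 2\<close>.
\<close>

end

theory Submission
  imports Defs "HOL-Complex_Analysis.Cauchy_Integral_Formula"
begin

text \<open>
  The joint density depends on the sample only through the mean \<open>y\<close> and the raw second moment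
  \<open>V = \<Sum>\<^sub>k X\<^sub>k X\<^sub>k'\<close>, and its logarithm is affine in \<open>(y, V)\<close>. Let \<open>h\<close> be the integrated likelihood under \<open>G\<close>
  minus \<open>c\<close> times the one under \<open>G\<^sub>0\<close>; it is continuous where \<open>S\<^sub>n\<close> is nonsingular, nonnegative
  inside the rejection region and nonpositive inside the acceptance region. Where \<open>y > 0\<close> the UIT
  statistic is Hotelling's \<open>T\<^sup>2\<close>, so \<open>h = 0\<close> on the part of the surface \<open>T\<^sup>2 = u\<close> with \<open>y > 0\<close>.

  There is a segment along which \<open>(y, V)\<close> is affine in \<open>t\<close>, which stays on \<open>T\<^sup>2 = u\<close>, and whose
  mean is \<open>(1, \<dots>, 1, t)\<close>. On it \<open>h\<close> is a difference of Laplace transforms, hence analytic in \<open>t\<close>;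
  it vanishes for \<open>t > 0\<close> and therefore also for \<open>t < 0\<close>. But there the statistic equals
  \<open>T\<^sup>2 - n y\<^sub>p\<^sup>2 / S\<^sub>p\<^sub>p < u\<close>, so that \<open>h \<le> 0\<close> in a whole neighbourhood. For fixed \<open>V\<close> the \<open>G\<^sub>0\<close>-term is
  constant and the \<open>G\<close>-term is convex in \<open>y\<close>; with an interior maximum it is constant in every
  direction, which forces \<open>\<theta> = 0\<close> almost surely under \<open>G\<close>, contradicting that \<open>G\<close> lives on \<open>\<theta> \<noteq> 0\<close>.
\<close>

subsection \<open>Positive definite matrices\<close>


lemma inner_mult_transpose:
  fixes A :: "real^'m^'k"
  shows "x \<bullet> (A *v y) = (transpose A *v x) \<bullet> y"
  by (metis dot_lmul_matrix transpose_transpose vector_transpose_matrix)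

lemma inner_symmetric_matrix:
  fixes A :: "real^'p^'p"
  assumes "transpose A = A"
  shows "x \<bullet> (A *v y) = (A *v x) \<bullet> y"
  using inner_mult_transpose[of x A y] assms by simp

lemma mult_matrix_inv:
  fixes A :: "real^'p^'p"
  assumes "det A \<noteq> 0"
  shows "A ** matrix_inv A = mat 1" "matrix_inv A ** A = mat 1"
proof -
  from assms obtain B where "A ** B = mat 1" "B ** A = mat 1"
    unfolding invertible_det_nz[symmetric] invertible_def by blast
  then have "A ** matrix_inv A = mat 1 \<and> matrix_inv A ** A = mat 1"
    unfolding matrix_inv_def by - (rule someI[of _ B], simp)
  then show "A ** matrix_inv A = mat 1" "matrix_inv A ** A = mat 1" by auto
qed

lemma mult_vec_matrix_inv:
  fixes A :: "real^'p^'p"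
  assumes "det A \<noteq> 0"
  shows "A *v (matrix_inv A *v x) = x" "matrix_inv A *v (A *v x) = x"
  by (simp_all add: matrix_vector_mul_assoc mult_matrix_inv[OF assms])

lemma matrix_inv_mult_eqI:
  fixes A :: "real^'p^'p"
  assumes "det A \<noteq> 0" "A *v x = y"
  shows "matrix_inv A *v y = x"
  using assms mult_vec_matrix_inv by metis

lemma det_matrix_inv:
  fixes A :: "real^'p^'p"
  assumes "det A \<noteq> 0"
  shows "det (matrix_inv A) = 1 / det A"
proof -
  have "det A * det (matrix_inv A) = 1"
    using arg_cong[OF mult_matrix_inv(1)[OF assms], of det] by (simp add: det_mul)
  then show ?thesis using assms by (simp add: field_simps)
qed

text \<open>Cramer's rule for the columns of the inverse. Writing the entries as quotients of
  determinants is what makes inversion visibly continuous below.\<close>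

lemma matrix_inv_component:
  fixes A :: "real^'p^'p"
  assumes "det A \<noteq> 0"
  shows "matrix_inv A $ i $ j = det (\<chi> k l. if l = i then axis j 1 $ k else A $ k $ l) / det A"
proof -
  have "matrix_inv A $ i $ j = (matrix_inv A *v axis j 1) $ i"
    by (simp add: matrix_vector_mult_basis column_def)
  also have "matrix_inv A *v axis j 1 = (\<chi> i. det (\<chi> k l. if l = i then axis j 1 $ k else A $ k $ l) / det A)"
    using cramer[OF assms, of "matrix_inv A *v axis j 1" "axis j 1"] mult_vec_matrix_inv[OF assms]
    by simp
  finally show ?thesis by simp
qed

lemma continuous_on_det:
  fixes A :: "'a::topological_space \<Rightarrow> real^'p^'p"
  assumes "continuous_on S A"
  shows "continuous_on S (\<lambda>x. det (A x))"
  unfolding det_def using assms by (intro continuous_intros)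

lemma continuous_on_matrix_inv:
  fixes A :: "'a::topological_space \<Rightarrow> real^'p^'p"
  assumes A: "continuous_on S A" and d: "\<And>x. x \<in> S \<Longrightarrow> det (A x) \<noteq> 0"
  shows "continuous_on S (\<lambda>x. matrix_inv (A x))"
proof -
  have c: "continuous_on S (\<lambda>x. if l = i then axis j 1 $ k else A x $ k $ l)" for i j k l :: 'p
    by (cases "l = i") (simp_all only: refl if_True if_False continuous_on_const continuous_on_component A)
  have "continuous_on S (\<lambda>x. \<chi> i j. det (\<chi> k l. if l = i then axis j 1 $ k else A x $ k $ l) / det (A x))"
    using d by (intro continuous_on_vec_lambda continuous_on_divide continuous_on_det A c ballI)
  moreover have "(\<chi> i j. det (\<chi> k l. if l = i then axis j 1 $ k else A x $ k $ l) / det (A x)) = matrix_inv (A x)"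
    if "x \<in> S" for x
    unfolding vec_eq_iff matrix_inv_component[OF d[OF that]] vec_lambda_beta by blast
  ultimately show ?thesis by (rule continuous_on_eq)
qed

lemma continuous_on_matrix_vector_mult:
  fixes A :: "'a::topological_space \<Rightarrow> real^'p^'q"
  assumes "continuous_on S A" "continuous_on S f"
  shows "continuous_on S (\<lambda>x. A x *v f x)"
  unfolding matrix_vector_mult_def using assms by (intro continuous_on_vec_lambda continuous_intros)

lemma det_nonzeroI:
  fixes A :: "real^'p^'p"
  assumes "\<And>x. A *v x = 0 \<Longrightarrow> x = 0"
  shows "det A \<noteq> 0"
proof -
  have "\<exists>B. B ** A = mat 1" using assms matrix_left_invertible_ker by blast
  then show ?thesis by (simp add: invertible_left_inverse[symmetric] invertible_det_nz)
qed

lemma pos_def_det_nonzero: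
  assumes "A \<in> pos_def_matrices"
  shows "det A \<noteq> 0"
proof (rule det_nonzeroI)
  fix x assume "A *v x = 0"
  then have "\<not> 0 < x \<bullet> (A *v x)" by simp
  then show "x = 0" using assms unfolding pos_def_matrices_def by blast
qed

text \<open>The segment from the identity to \<open>A\<close> stays inside the positive definite
  matrices, where the determinant cannot vanish, so the determinant keeps the sign it has at the
  identity.\<close>

lemma pos_def_det_pos:
  fixes A :: "real^'p^'p"
  assumes "A \<in> pos_def_matrices"
  shows "0 < det A"
proof (rule ccontr)
  assume "\<not> 0 < det A"
  let ?B = "\<lambda>t::real. (1 - t) *\<^sub>R mat 1 + t *\<^sub>R A"
  have B: "?B t \<in> pos_def_matrices" if "0 \<le> t" "t \<le> 1" for t
  proof -
    have "0 < x \<bullet> (?B t *v x)" if "x \<noteq> 0" for x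
    proof -
      have "0 < x \<bullet> (A *v x)" "0 < x \<bullet> x" using assms that by (auto simp: pos_def_matrices_def)
      have "x \<bullet> (?B t *v x) = (1 - t) * (x \<bullet> x) + t * (x \<bullet> (A *v x))"
        by (simp add: matrix_vector_mult_add_rdistrib inner_add_right scaleR_matrix_vector_assoc[symmetric])
      also have "\<dots> > 0"
      proof (cases "t = 1")
        case False
        then have "0 < (1 - t) * (x \<bullet> x)" using \<open>t \<le> 1\<close> \<open>0 < x \<bullet> x\<close> by simp
        moreover have "0 \<le> t * (x \<bullet> (A *v x))" using \<open>0 \<le> t\<close> \<open>0 < x \<bullet> (A *v x)\<close> by simp
        ultimately show ?thesis by linarith
      qed (use \<open>0 < x \<bullet> (A *v x)\<close> in simp)
      finally show ?thesis .
    qed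
    moreover have "transpose (?B t) = ?B t"
      using assms by (auto simp: pos_def_matrices_def vec_eq_iff transpose_def mat_def)
    ultimately show ?thesis by (simp add: pos_def_matrices_def)
  qed
  have cont: "continuous_on {0..1} (\<lambda>t. det (?B t))"
    by (intro continuous_on_det continuous_intros)
  have "\<exists>t\<ge>0. t \<le> 1 \<and> det (?B t) = 0"
    using \<open>\<not> 0 < det A\<close> by (intro IVT2' cont) auto
  then show False using B pos_def_det_nonzero by blast
qed

lemma pos_def_matrix_inv:
  fixes A :: "real^'p^'p"
  assumes "A \<in> pos_def_matrices"
  shows "matrix_inv A \<in> pos_def_matrices"
proof -
  note d = pos_def_det_nonzero[OF assms]
  have s: "transpose A = A" using assms by (simp add: pos_def_matrices_def)
  let ?B = "matrix_inv A"
  have "transpose ?B = transpose ?B ** (A ** ?B)" by (simp add: mult_matrix_inv[OF d])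
  also have "\<dots> = transpose (A ** ?B) ** ?B"
    by (simp add: matrix_mul_assoc matrix_transpose_mul s)
  also have "\<dots> = ?B" by (simp add: mult_matrix_inv[OF d])
  finally have sB: "transpose ?B = ?B" .
  have "0 < x \<bullet> (?B *v x)" if "x \<noteq> 0" for x
  proof -
    have "?B *v x \<noteq> 0" using that mult_vec_matrix_inv[OF d] by (metis matrix_vector_mult_0_right)
    then have "0 < (?B *v x) \<bullet> (A *v (?B *v x))" using assms by (simp add: pos_def_matrices_def)
    then show ?thesis by (simp add: mult_vec_matrix_inv[OF d] inner_commute)
  qed
  with sB show ?thesis by (simp add: pos_def_matrices_def)
qed

lemma pos_def_quad_nonneg: "A \<in> pos_def_matrices \<Longrightarrow> 0 \<le> x \<bullet> (A *v x)"
  by (cases "x = 0") (auto simp: pos_def_matrices_def less_imp_le)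

text \<open>A crude Leibniz bound: positivity on \<open>axis i 1 \<plusminus> axis j 1\<close>
  bounds every entry by the trace, and there are \<open>fact CARD('p)\<close> products. The constant
  is irrelevant; only a power of the trace is wanted in the density bound.\<close>

lemma pos_def_det_le_trace:
  fixes A :: "real^'p^'p"
  assumes "A \<in> pos_def_matrices"
  shows "det A \<le> fact CARD('p) * (\<Sum>i\<in>UNIV. A $ i $ i) ^ CARD('p)"
proof -
  let ?\<tau> = "\<Sum>i\<in>UNIV. A $ i $ i"
  have s: "A $ j $ i = A $ i $ j" for i j
  proof -
    have "transpose A $ i $ j = A $ i $ j" using assms by (simp add: pos_def_matrices_def)
    then show ?thesis by (simp only: transpose_def vec_lambda_beta)
  qed
  have e: "axis i 1 \<bullet> (A *v axis j 1) = A $ i $ j" for i j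
    by (simp add: inner_axis' matrix_vector_mult_basis column_def)
  have q: "0 \<le> A $ i $ i + A $ j $ j + 2 * s * A $ i $ j" if "s = 1 \<or> s = -1" for i j and s :: real
  proof -
    have "0 \<le> (axis i 1 + s *\<^sub>R axis j 1) \<bullet> (A *v (axis i 1 + s *\<^sub>R axis j 1))"
      by (rule pos_def_quad_nonneg[OF assms])
    also have "\<dots> = A $ i $ i + s * s * A $ j $ j + 2 * s * A $ i $ j"
      unfolding matrix_vector_right_distrib matrix_vector_mult_scaleR inner_add_left inner_add_right
        inner_scaleR_left inner_scaleR_right e s[of i j] by (simp add: algebra_simps)
    finally show ?thesis using that by auto
  qed
  have d0: "0 \<le> A $ i $ i" for i using pos_def_quad_nonneg[OF assms, of "axis i 1"] by (simp only: e)
  have diag: "A $ i $ i \<le> ?\<tau>" for i by (rule member_le_sum) (auto simp: d0)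
  have ent: "\<bar>A $ i $ j\<bar> \<le> ?\<tau>" for i j
    using q[of 1 i j] q[of "-1" i j] diag[of i] diag[of j] by simp
  have "det A \<le> (\<Sum>\<pi>\<in>{\<pi>. \<pi> permutes (UNIV::'p set)}. \<bar>of_int (sign \<pi>) * (\<Prod>i\<in>UNIV. A $ i $ \<pi> i)\<bar>)"
    unfolding det_def by (intro sum_mono) (simp only: abs_ge_self)
  also have "\<dots> \<le> (\<Sum>\<pi>\<in>{\<pi>. \<pi> permutes (UNIV::'p set)}. ?\<tau> ^ CARD('p))"
  proof (intro sum_mono)
    fix \<pi> :: "'p \<Rightarrow> 'p"
    have "\<bar>of_int (sign \<pi>) * (\<Prod>i\<in>UNIV. A $ i $ \<pi> i)\<bar> = (\<Prod>i\<in>UNIV. \<bar>A $ i $ \<pi> i\<bar>)"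
      by (simp add: abs_mult abs_prod sign_def)
    also have "\<dots> \<le> (\<Prod>i\<in>(UNIV::'p set). ?\<tau>)" by (intro prod_mono) (simp add: ent)
    finally show "\<bar>of_int (sign \<pi>) * (\<Prod>i\<in>UNIV. A $ i $ \<pi> i)\<bar> \<le> ?\<tau> ^ CARD('p)" by simp
  qed
  also have "\<dots> = fact CARD('p) * ?\<tau> ^ CARD('p)" by (simp add: card_permutations[OF refl])
  finally show ?thesis .
qed


subsection \<open>Integrated likelihoods\<close>

lemma sum_deviations_eq_0:
  fixes X :: "real^'p^'n"
  shows "(\<Sum>k\<in>UNIV. X $ k - sample_mean X) = 0"
  by (simp add: sample_mean_def sum_subtractf sum_constant_scaleR del: sum_constant)

lemma sample_cov_mult_vec:
  fixes X :: "real^'p^'n"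
  shows "sample_cov X *v y = (1 / (real CARD('n) - 1)) *\<^sub>R
    (\<Sum>k\<in>UNIV. ((X $ k - sample_mean X) \<bullet> y) *\<^sub>R (X $ k - sample_mean X))"
proof (subst vec_eq_iff, intro allI)
  fix i
  have "(sample_cov X *v y) $ i = (\<Sum>j\<in>UNIV. \<Sum>k\<in>UNIV. (1 / (real CARD('n) - 1)) *
     ((X $ k - sample_mean X) $ i * (X $ k - sample_mean X) $ j) * y $ j)"
    by (simp add: matrix_vector_mult_def sample_cov_def sum_distrib_left sum_distrib_right)
  also have "\<dots> = (\<Sum>k\<in>UNIV. \<Sum>j\<in>UNIV. (1 / (real CARD('n) - 1)) *
     ((X $ k - sample_mean X) $ i * (X $ k - sample_mean X) $ j) * y $ j)" by (rule sum.swap)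
  also have "\<dots> = ((1 / (real CARD('n) - 1)) *\<^sub>R
    (\<Sum>k\<in>UNIV. ((X $ k - sample_mean X) \<bullet> y) *\<^sub>R (X $ k - sample_mean X))) $ i"
    by (simp add: inner_vec_def sum_distrib_left sum_distrib_right mult_ac sum_component)
  finally show "(sample_cov X *v y) $ i = \<dots>" .
qed

lemma transpose_sample_cov: "transpose (sample_cov X) = sample_cov X"
  by (simp add: vec_eq_iff transpose_def sample_cov_def mult_ac)

lemma sample_cov_quad:
  fixes X :: "real^'p^'n"
  shows "x \<bullet> (sample_cov X *v x) =
    (1 / (real CARD('n) - 1)) * (\<Sum>k\<in>UNIV. ((X $ k - sample_mean X) \<bullet> x)\<^sup>2)"
  unfolding sample_cov_mult_vec
  by (simp add: inner_sum_right power2_eq_square inner_commute)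

text \<open>The quadratic form is a multiple of a sum of squares, and a vector on which it vanishes
  is orthogonal to all deviations, hence in the kernel of \<open>sample_cov X\<close>.\<close>

lemma pos_def_sample_cov:
  fixes X :: "real^'p^'n"
  assumes n: "1 < CARD('n)" and d: "det (sample_cov X) \<noteq> 0"
  shows "sample_cov X \<in> pos_def_matrices"
proof -
  have "0 < x \<bullet> (sample_cov X *v x)" if "x \<noteq> 0" for x
  proof (rule ccontr)
    assume "\<not> 0 < x \<bullet> (sample_cov X *v x)"
    then have "(\<Sum>k\<in>UNIV. ((X $ k - sample_mean X) \<bullet> x)\<^sup>2) \<le> 0"
      using n by (auto simp: sample_cov_quad zero_less_divide_iff not_less)
    moreover have "0 \<le> (\<Sum>k\<in>UNIV. ((X $ k - sample_mean X) \<bullet> x)\<^sup>2)" by (intro sum_nonneg) simp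
    ultimately have "(\<Sum>k\<in>UNIV. ((X $ k - sample_mean X) \<bullet> x)\<^sup>2) = 0" by linarith
    then have "(X $ k - sample_mean X) \<bullet> x = 0" for k
      by (subst (asm) sum_nonneg_eq_0_iff) auto
    then have "sample_cov X *v x = 0" by (simp add: sample_cov_mult_vec)
    then show False using mult_vec_matrix_inv(2)[OF d, of x] that by simp
  qed
  then show ?thesis by (simp add: pos_def_matrices_def transpose_sample_cov)
qed

lemma continuous_on_sample_mean: "continuous_on S (\<lambda>X :: real^'p^'n. sample_mean X)"
  unfolding sample_mean_def by (intro continuous_intros)

lemma continuous_on_sample_cov: "continuous_on S (\<lambda>X :: real^'p^'n. sample_cov X)"
  unfolding sample_cov_def by (intro continuous_on_vec_lambda continuous_intros continuous_on_sample_mean)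

text \<open>Minus twice the exponent of the joint density. The argument \<open>\<Lambda>\<close>
  stands for the precision matrix, in which the expression is linear.\<close>

definition residual_quad :: "real^'p \<Rightarrow> real^'p^'p \<Rightarrow> real^'p^'n \<Rightarrow> real" where
  "residual_quad \<theta> \<Lambda> X = (\<Sum>k\<in>UNIV. (X $ k - \<theta>) \<bullet> (\<Lambda> *v (X $ k - \<theta>)))"

lemma joint_density_eq:
  fixes X :: "real^'p^'n"
  shows "joint_density \<theta> \<Sigma> X =
    exp (- residual_quad \<theta> (matrix_inv \<Sigma>) X / 2) / sqrt ((2 * pi) ^ CARD('p) * det \<Sigma>) ^ CARD('n)"
proof -
  have "(\<Prod>k\<in>(UNIV::'n set). exp (- ((X $ k - \<theta>) \<bullet> (matrix_inv \<Sigma> *v (X $ k - \<theta>))) / 2))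
      = exp (- residual_quad \<theta> (matrix_inv \<Sigma>) X / 2)"
    by (simp add: exp_sum[symmetric] residual_quad_def sum_negf[symmetric] sum_divide_distrib)
  then show ?thesis
    by (simp add: joint_density_def mvn_density_def prod_dividef)
qed

lemma joint_density_pos: "\<Sigma> \<in> pos_def_matrices \<Longrightarrow> 0 < joint_density \<theta> \<Sigma> X"
  using pos_def_det_pos[of \<Sigma>] by (simp add: joint_density_eq)

text \<open>Continuity in the parameter for a fixed sample, needed to integrate the density against
  a prior.\<close>

lemma continuous_on_joint_density:
  "continuous_on (UNIV \<times> pos_def_matrices) (\<lambda>\<omega>. joint_density (fst \<omega>) (snd \<omega>) X)"
  unfolding joint_density_eq residual_quad_def
  by (intro continuous_intros continuous_on_det continuous_on_matrix_vector_mult continuous_on_matrix_inv)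
    (auto dest: pos_def_det_nonzero pos_def_det_pos)

lemma continuous_on_joint_density_sample:
  assumes "\<Sigma> \<in> pos_def_matrices"
  shows "continuous_on S (\<lambda>X. joint_density \<theta> \<Sigma> X)"
  unfolding joint_density_eq residual_quad_def
  using pos_def_det_pos[OF assms]
  by (intro continuous_intros continuous_on_matrix_vector_mult) auto

text \<open>The cross term disappears because the deviations sum to zero. Hence the exponent is
  largest at \<theta> equal to the sample mean.\<close>

lemma residual_quad_decomp:
  fixes X :: "real^'p^'n"
  assumes "transpose \<Lambda> = \<Lambda>"
  shows "residual_quad \<theta> \<Lambda> X = residual_quad (sample_mean X) \<Lambda> X
    + real CARD('n) * ((sample_mean X - \<theta>) \<bullet> (\<Lambda> *v (sample_mean X - \<theta>)))"
proof -
  let ?m = "sample_mean X"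
  have "(X $ k - \<theta>) \<bullet> (\<Lambda> *v (X $ k - \<theta>)) = (X $ k - ?m) \<bullet> (\<Lambda> *v (X $ k - ?m))
    + 2 * ((X $ k - ?m) \<bullet> (\<Lambda> *v (?m - \<theta>))) + (?m - \<theta>) \<bullet> (\<Lambda> *v (?m - \<theta>))" for k
  proof -
    have "X $ k - \<theta> = (X $ k - ?m) + (?m - \<theta>)" by simp
    moreover have "(u + v) \<bullet> (\<Lambda> *v (u + v)) = u \<bullet> (\<Lambda> *v u) + 2 * (u \<bullet> (\<Lambda> *v v)) + v \<bullet> (\<Lambda> *v v)" for u v
      using inner_symmetric_matrix[OF assms, of u v]
      by (simp add: matrix_vector_right_distrib inner_add_left inner_add_right inner_commute)
    ultimately show ?thesis by metis
  qed
  then have "residual_quad \<theta> \<Lambda> X = residual_quad ?m \<Lambda> X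
    + 2 * ((\<Sum>k\<in>UNIV. X $ k - ?m) \<bullet> (\<Lambda> *v (?m - \<theta>))) + real CARD('n) * ((?m - \<theta>) \<bullet> (\<Lambda> *v (?m - \<theta>)))"
    by (simp add: residual_quad_def sum.distrib sum_distrib_left inner_sum_left)
  then show ?thesis by (simp only: sum_deviations_eq_0) simp
qed

section \<open>A bound on the joint density that is uniform in the parameter\<close>

definition precision_trace :: "real^'p^'n \<Rightarrow> real" where
  "precision_trace X = (\<Sum>i\<in>UNIV. matrix_inv (sample_cov X) $ i $ i)"

text \<open>With a nonsingular sample covariance each basis vector is a combination of the
  deviations, so a large \<Lambda> must show up in their residual form. This is what prevents the
  likelihood from blowing up for nearly singular \<Sigma>.\<close>

lemma trace_le_residual_quad:
  fixes X :: "real^'p^'n"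
  assumes n: "1 < CARD('n)" and d: "det (sample_cov X) \<noteq> 0" and \<Lambda>: "\<Lambda> \<in> pos_def_matrices"
  shows "(\<Sum>i\<in>UNIV. \<Lambda> $ i $ i) \<le>
    precision_trace X / (real CARD('n) - 1) * residual_quad (sample_mean X) \<Lambda> X"
proof -
  let ?z = "\<lambda>k. X $ k - sample_mean X" and ?N = "real CARD('n) - 1"
  let ?q = "residual_quad (sample_mean X) \<Lambda> X"
  have N: "0 < ?N" using n by simp
  have \<Lambda>s: "transpose \<Lambda> = \<Lambda>" using \<Lambda> by (simp add: pos_def_matrices_def)
  have "\<Lambda> $ i $ i \<le> matrix_inv (sample_cov X) $ i $ i / ?N * ?q" for i
  proof -
    let ?e = "axis i 1 :: real^'p"
    \<comment> \<open>Reading \<open>?e\<close> as \<open>sample_cov X *v w\<close> expands it in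
      the deviations, with coefficients \<open>c k\<close>; their sum of squares \<open>C\<close>
      turns out to be a diagonal entry of the inverse covariance up to the factor
      \<open>1 / ?N\<close>.\<close>
    define w where "w = matrix_inv (sample_cov X) *v ?e"
    define c where "c k = (?z k \<bullet> w) / ?N" for k
    define C where "C = (\<Sum>k\<in>UNIV. (c k)\<^sup>2)"
    have e: "?e = (\<Sum>k\<in>UNIV. c k *\<^sub>R ?z k)"
      using mult_vec_matrix_inv(1)[OF d, of ?e] unfolding w_def[symmetric] sample_cov_mult_vec c_def
      by (simp add: scaleR_sum_right)
    have "w \<noteq> 0" using mult_vec_matrix_inv(1)[OF d, of ?e] by (auto simp: w_def)
    have Cw: "C = w \<bullet> (sample_cov X *v w) / ?N"
      using N unfolding C_def c_def sample_cov_quad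
      by (simp add: power_divide sum_divide_distrib[symmetric] power2_eq_square)
    have "0 < w \<bullet> (sample_cov X *v w)"
      using pos_def_sample_cov[OF n d] \<open>w \<noteq> 0\<close> by (simp add: pos_def_matrices_def)
    then have "0 < C" using N by (simp add: Cw)
    have "w \<bullet> (sample_cov X *v w) = matrix_inv (sample_cov X) $ i $ i"
      unfolding w_def mult_vec_matrix_inv(1)[OF d] by (simp add: inner_axis matrix_vector_mult_basis column_def)
    then have C: "C = matrix_inv (sample_cov X) $ i $ i / ?N" by (simp add: Cw)
    \<comment> \<open>Cauchy--Schwarz for the form \<open>\<Lambda>\<close> applied to \<open>e = \<Sum>\<^sub>k c\<^sub>k z\<^sub>k\<close>\<close>
    have "0 \<le> (\<Sum>k\<in>UNIV. (C *\<^sub>R ?z k - c k *\<^sub>R ?e) \<bullet> (\<Lambda> *v (C *\<^sub>R ?z k - c k *\<^sub>R ?e)))"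
      by (intro sum_nonneg pos_def_quad_nonneg[OF \<Lambda>])
    also have "\<dots> = (\<Sum>k\<in>UNIV. C\<^sup>2 * (?z k \<bullet> (\<Lambda> *v ?z k)) - 2 * C * ((c k *\<^sub>R ?z k) \<bullet> (\<Lambda> *v ?e))
        + (c k)\<^sup>2 * (?e \<bullet> (\<Lambda> *v ?e)))"
    proof (intro sum.cong refl)
      fix k
      have "(C *\<^sub>R z - c k *\<^sub>R e) \<bullet> (\<Lambda> *v (C *\<^sub>R z - c k *\<^sub>R e)) =
          C\<^sup>2 * (z \<bullet> (\<Lambda> *v z)) - 2 * C * ((c k *\<^sub>R z) \<bullet> (\<Lambda> *v e)) + (c k)\<^sup>2 * (e \<bullet> (\<Lambda> *v e))" for z e
      proof -
        have "e \<bullet> (\<Lambda> *v z) = z \<bullet> (\<Lambda> *v e)"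
          using inner_symmetric_matrix[OF \<Lambda>s, of e z] by (simp only: inner_commute)
        then show ?thesis
          by (simp add: matrix_vector_mult_diff_distrib matrix_vector_mult_scaleR inner_diff_left
              inner_diff_right algebra_simps power2_eq_square)
      qed
      then show "(C *\<^sub>R ?z k - c k *\<^sub>R ?e) \<bullet> (\<Lambda> *v (C *\<^sub>R ?z k - c k *\<^sub>R ?e)) =
          C\<^sup>2 * (?z k \<bullet> (\<Lambda> *v ?z k)) - 2 * C * ((c k *\<^sub>R ?z k) \<bullet> (\<Lambda> *v ?e)) + (c k)\<^sup>2 * (?e \<bullet> (\<Lambda> *v ?e))" .
    qed
    also have "\<dots> = C\<^sup>2 * ?q - 2 * C * (?e \<bullet> (\<Lambda> *v ?e)) + C * (?e \<bullet> (\<Lambda> *v ?e))"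
      unfolding sum.distrib sum_subtractf sum_distrib_left[symmetric] sum_distrib_right[symmetric]
        inner_sum_left[symmetric] e[symmetric] C_def[symmetric] residual_quad_def[symmetric] by simp
    finally have "C * (?e \<bullet> (\<Lambda> *v ?e)) \<le> C * (C * ?q)" by (simp add: power2_eq_square algebra_simps)
    then have "?e \<bullet> (\<Lambda> *v ?e) \<le> C * ?q" using \<open>0 < C\<close> by simp
    then show ?thesis unfolding C by (simp add: inner_axis' matrix_vector_mult_basis column_def)
  qed
  then have "(\<Sum>i\<in>UNIV. \<Lambda> $ i $ i) \<le> (\<Sum>i\<in>UNIV. matrix_inv (sample_cov X) $ i $ i / ?N * ?q)"
    by (intro sum_mono)
  then show ?thesis by (simp add: precision_trace_def sum_divide_distrib sum_distrib_right)
qed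


text \<open>A single term of the exponential series is at most the whole series. It lets
  \<open>exp (- q)\<close> absorb any power of \<open>q\<close>.\<close>

lemma power_le_fact_exp: "x ^ m \<le> fact m * exp x" if "0 \<le> x" for x :: real
proof -
  have "x ^ m / fact m = (\<Sum>n\<in>{m}. x ^ n / fact n)" by simp
  also have "\<dots> \<le> exp x"
    using that sum_le_suminf[of "\<lambda>n. x ^ n / fact n" "{m}"] summable_exp_generic[of x]
    by (simp add: exp_def divide_inverse mult.commute)
  finally show ?thesis by (simp add: field_simps)
qed

text \<open>Free of \<theta> and \<Sigma>. The outer root is there because the square of the density
  is what gets bounded, which removes the root of the determinant.\<close>

definition density_bound :: "real^'p^'n \<Rightarrow> real" where
  "density_bound X = sqrt (fact CARD('p) ^ CARD('n) *
     (precision_trace X / (real CARD('n) - 1)) ^ (CARD('p) * CARD('n)) * fact (CARD('p) * CARD('n)))"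

lemma joint_density_le_density_bound:
  fixes X :: "real^'p^'n"
  assumes n: "1 < CARD('n)" and d: "det (sample_cov X) \<noteq> 0" and \<Sigma>: "\<Sigma> \<in> pos_def_matrices"
  shows "joint_density \<theta> \<Sigma> X \<le> density_bound X"
proof -
  let ?\<Lambda> = "matrix_inv \<Sigma>" and ?p = "CARD('p)" and ?n = "CARD('n)"
  let ?q = "residual_quad (sample_mean X) ?\<Lambda> X" and ?\<tau> = "\<Sum>i\<in>UNIV. ?\<Lambda> $ i $ i"
  let ?t = "precision_trace X / (real CARD('n) - 1)"
  have \<Lambda>: "?\<Lambda> \<in> pos_def_matrices" by (rule pos_def_matrix_inv[OF \<Sigma>])
  then have s: "transpose ?\<Lambda> = ?\<Lambda>" by (simp add: pos_def_matrices_def)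
  have q0: "0 \<le> ?q" unfolding residual_quad_def by (intro sum_nonneg pos_def_quad_nonneg[OF \<Lambda>])
  have \<tau>0: "0 \<le> ?\<tau>"
  proof (intro sum_nonneg)
    fix i show "0 \<le> ?\<Lambda> $ i $ i"
      using pos_def_quad_nonneg[OF \<Lambda>, of "axis i 1"]
      by (simp add: inner_axis' matrix_vector_mult_basis column_def)
  qed
  have dS: "0 < det \<Sigma>" and dL: "det ?\<Lambda> = 1 / det \<Sigma>" "0 < det ?\<Lambda>"
    using pos_def_det_pos[OF \<Sigma>] pos_def_det_pos[OF \<Lambda>] det_matrix_inv[of \<Sigma>] by auto
  have t0: "0 \<le> ?t"
  proof -
    have P: "matrix_inv (sample_cov X) \<in> pos_def_matrices"
      by (intro pos_def_matrix_inv pos_def_sample_cov n d)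
    have "0 \<le> matrix_inv (sample_cov X) $ i $ i" for i
      using pos_def_quad_nonneg[OF P, of "axis i 1"]
      by (simp add: inner_axis' matrix_vector_mult_basis column_def)
    then show ?thesis using n by (simp add: precision_trace_def sum_nonneg)
  qed
  have "(joint_density \<theta> \<Sigma> X)\<^sup>2 = exp (- residual_quad \<theta> ?\<Lambda> X) * (1 / ((2 * pi) ^ ?p * det \<Sigma>)) ^ ?n"
  proof -
    have "(sqrt D ^ k)\<^sup>2 = D ^ k" if "0 \<le> D" for D :: real and k
      using that by (metis power_mult mult.commute real_sqrt_pow2)
    moreover have "0 \<le> (2 * pi) ^ ?p * det \<Sigma>" using dS by simp
    moreover have "(exp (- r / 2))\<^sup>2 = exp (- r)" for r :: real
      by (simp add: exp_double[symmetric])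
    ultimately show ?thesis by (simp only: joint_density_eq power_divide power_one) simp
  qed
  also have "\<dots> \<le> exp (- ?q) * (det ?\<Lambda>) ^ ?n"
  proof (intro mult_mono power_mono)
    have "0 \<le> (sample_mean X - \<theta>) \<bullet> (?\<Lambda> *v (sample_mean X - \<theta>))" by (rule pos_def_quad_nonneg[OF \<Lambda>])
    then have "?q \<le> residual_quad \<theta> ?\<Lambda> X" unfolding residual_quad_decomp[OF s, of \<theta>] by simp
    then show "exp (- residual_quad \<theta> ?\<Lambda> X) \<le> exp (- ?q)" by simp
    have "1 \<le> (2 * pi) ^ ?p" using pi_ge_two by (intro one_le_power) simp
    then show "1 / ((2 * pi) ^ ?p * det \<Sigma>) \<le> det ?\<Lambda>"
      using dS by (simp add: dL(1) field_simps)
  qed (use dS in auto)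
  \<comment> \<open>The determinant of the precision is traded for the trace and then for
    \<open>?q\<close>, so that everything depending on \<Sigma> sits in one expression
    \<open>?q ^ (?p * ?n) * exp (- ?q)\<close>.\<close>
  also have "\<dots> \<le> exp (- ?q) * (fact ?p * (?t * ?q) ^ ?p) ^ ?n"
  proof (intro mult_left_mono power_mono)
    have "det ?\<Lambda> \<le> fact ?p * ?\<tau> ^ ?p" by (rule pos_def_det_le_trace[OF \<Lambda>])
    also have "\<dots> \<le> fact ?p * (?t * ?q) ^ ?p"
      by (intro mult_left_mono power_mono trace_le_residual_quad[OF n d \<Lambda>] \<tau>0) simp
    finally show "det ?\<Lambda> \<le> fact ?p * (?t * ?q) ^ ?p" .
  qed (use dL in auto)
  also have "\<dots> = fact ?p ^ ?n * ?t ^ (?p * ?n) * (?q ^ (?p * ?n) * exp (- ?q))"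
    by (simp only: power_mult_distrib power_mult[symmetric]) (simp only: mult_ac)
  also have "\<dots> \<le> fact ?p ^ ?n * ?t ^ (?p * ?n) * fact (?p * ?n)"
  proof (intro mult_left_mono)
    show "?q ^ (?p * ?n) * exp (- ?q) \<le> fact (?p * ?n)"
      using power_le_fact_exp[OF q0, of "?p * ?n"] by (simp add: exp_minus field_simps)
  qed (use t0 in simp)
  finally show ?thesis unfolding density_bound_def by (rule real_le_rsqrt)
qed

lemma continuous_on_density_bound:
  "continuous_on {X :: real^'p^'n. det (sample_cov X) \<noteq> 0} density_bound"
  if "1 < CARD('n)"
  unfolding density_bound_def precision_trace_def using that
  by (intro continuous_intros continuous_on_component continuous_on_matrix_inv continuous_on_sample_cov) auto

section \<open>Integrability, positivity and continuity of the integrated likelihood\<close>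

definition likelihood :: "((real^'p) \<times> (real^'p^'p)) measure \<Rightarrow> real^'p^'n \<Rightarrow> real" where
  "likelihood G X = (\<integral>\<omega>. joint_density (fst \<omega>) (snd \<omega>) X \<partial>G)"

lemma prior_on_measurable:
  assumes "prior_on (T \<times> pos_def_matrices) G"
    and "continuous_on (UNIV \<times> pos_def_matrices) f"
  shows "f \<in> borel_measurable G"
proof -
  have "f \<in> borel_measurable (restrict_space borel (T \<times> pos_def_matrices))"
    by (intro borel_measurable_continuous_on_restrict continuous_on_subset[OF assms(2)]) auto
  moreover have "borel_measurable G = borel_measurable (restrict_space borel (T \<times> pos_def_matrices))"
    using assms(1) by (intro measurable_cong_sets) (simp_all add: prior_on_def)
  ultimately show ?thesis by blast
qed

lemma open_nonsingular: "open {X :: real^'p^'n. det (sample_cov X) \<noteq> 0}"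
proof -
  have "open ((\<lambda>X :: real^'p^'n. det (sample_cov X)) -` (- {0}))"
    by (intro open_vimage continuous_on_det continuous_on_sample_cov) auto
  then show ?thesis by (simp add: vimage_def)
qed

lemma prior_on_space:
  assumes "prior_on (T \<times> pos_def_matrices) G" "\<omega> \<in> space G"
  shows "snd \<omega> \<in> pos_def_matrices" "fst \<omega> \<in> T"
  using assms by (auto simp: prior_on_def)

lemma joint_density_prior_pos:
  assumes "prior_on (T \<times> pos_def_matrices) G" "\<omega> \<in> space G"
  shows "0 < joint_density (fst \<omega>) (snd \<omega>) X"
  by (intro joint_density_pos prior_on_space[OF assms])

context
  fixes T :: "(real^'p) set" and G
  assumes n: "1 < CARD('n::finite)" and G: "prior_on (T \<times> pos_def_matrices) G"
begin

lemma integrable_joint_density: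
  assumes "det (sample_cov (X :: real^'p^'n)) \<noteq> 0"
  shows "integrable G (\<lambda>\<omega>. joint_density (fst \<omega>) (snd \<omega>) X)"
proof -
  interpret prob_space G using G by (simp add: prior_on_def)
  show ?thesis
  proof (rule integrable_const_bound[where B = "density_bound X"])
    have "norm (joint_density (fst \<omega>) (snd \<omega>) X) \<le> density_bound X" if "\<omega> \<in> space G" for \<omega>
      using joint_density_le_density_bound[OF n assms prior_on_space(1)[OF G that], of "fst \<omega>"]
        joint_density_prior_pos[OF G that, of X] by simp
    then show "AE \<omega> in G. norm (joint_density (fst \<omega>) (snd \<omega>) X) \<le> density_bound X"
      by (intro AE_I2)
  qed (rule prior_on_measurable[OF G continuous_on_joint_density])
qed

lemma likelihood_pos:
  assumes "det (sample_cov (X :: real^'p^'n)) \<noteq> 0"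
  shows "0 < likelihood G X"
proof -
  interpret prob_space G using G by (simp add: prior_on_def)
  show ?thesis unfolding likelihood_def
    by (intro expectation_greater integrable_joint_density[OF assms] AE_I2 joint_density_prior_pos[OF G])
qed

text \<open>Dominated convergence along sequences. Near a nonsingular sample the continuous
  \<open>density_bound\<close> stays below \<open>density_bound X + 1\<close>, a constant integrable
  under the probability measure \<open>G\<close>.\<close>

lemma continuous_on_likelihood:
  "continuous_on {X :: real^'p^'n. det (sample_cov X) \<noteq> 0} (likelihood G)"
proof (subst continuous_on_eq_continuous_at[OF open_nonsingular], intro ballI)
  fix X :: "real^'p^'n" assume X: "X \<in> {X. det (sample_cov X) \<noteq> 0}"
  interpret prob_space G using G by (simp add: prior_on_def)
  have cb: "isCont density_bound X"
    using continuous_on_density_bound[where ?'p = 'p, OF n] X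
    unfolding continuous_on_eq_continuous_at[OF open_nonsingular] by blast
  have cd: "isCont (\<lambda>X :: real^'p^'n. det (sample_cov X)) X"
  proof -
    have "continuous_on UNIV (\<lambda>X :: real^'p^'n. det (sample_cov X))"
      by (intro continuous_on_det continuous_on_sample_cov)
    then show ?thesis by (simp add: continuous_on_eq_continuous_at)
  qed
  show "isCont (likelihood G) X"
  proof (rule continuous_at_sequentiallyI)
    fix Y assume Y: "Y \<longlonglongrightarrow> X"
    have "\<forall>\<^sub>F k in sequentially. density_bound (Y k) < density_bound X + 1"
      by (rule order_tendstoD(2)[OF isCont_tendsto_compose[OF cb Y]]) simp
    moreover have "\<forall>\<^sub>F k in sequentially. det (sample_cov (Y k)) \<noteq> 0"
      using X by (intro tendsto_imp_eventually_ne[OF isCont_tendsto_compose[OF cd Y]]) simp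
    ultimately have "\<forall>\<^sub>F k in sequentially. density_bound (Y k) < density_bound X + 1 \<and> det (sample_cov (Y k)) \<noteq> 0"
      by (rule eventually_conj)
    \<comment> \<open>The bound holds only eventually, so the sequence is shifted by
      \<open>K\<close>; \<open>LIMSEQ_offset\<close> undoes the shift at the end.\<close>
    then obtain K where K: "\<And>k. density_bound (Y (k + K)) < density_bound X + 1"
        "\<And>k. det (sample_cov (Y (k + K))) \<noteq> 0"
      unfolding eventually_sequentially by (metis le_add2)
    have "(\<lambda>k. likelihood G (Y (k + K))) \<longlonglongrightarrow> likelihood G X"
      unfolding likelihood_def
    proof (rule integral_dominated_convergence[where w = "\<lambda>_. density_bound X + 1"])
      show "AE \<omega> in G. (\<lambda>k. joint_density (fst \<omega>) (snd \<omega>) (Y (k + K))) \<longlonglongrightarrow> joint_density (fst \<omega>) (snd \<omega>) X"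
      proof (intro AE_I2 LIMSEQ_ignore_initial_segment)
        fix \<omega> assume "\<omega> \<in> space G"
        then have "isCont (\<lambda>X. joint_density (fst \<omega>) (snd \<omega>) X) X"
          using continuous_on_joint_density_sample[OF prior_on_space(1)[OF G], of \<omega> "UNIV :: (real^'p^'n) set" "fst \<omega>"]
          by (simp add: continuous_on_eq_continuous_at)
        then show "(\<lambda>k. joint_density (fst \<omega>) (snd \<omega>) (Y k)) \<longlonglongrightarrow> joint_density (fst \<omega>) (snd \<omega>) X"
          using Y by (rule isCont_tendsto_compose)
      qed
      show "AE \<omega> in G. norm (joint_density (fst \<omega>) (snd \<omega>) (Y (k + K))) \<le> density_bound X + 1" for k
      proof (rule AE_I2)
        fix \<omega> assume w: "\<omega> \<in> space G"
        show "norm (joint_density (fst \<omega>) (snd \<omega>) (Y (k + K))) \<le> density_bound X + 1"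
          using joint_density_le_density_bound[OF n K(2)[of k] prior_on_space(1)[OF G w], of "fst \<omega>"]
            joint_density_prior_pos[OF G w, of "Y (k + K)"] K(1)[of k] by simp
      qed
    qed (auto intro!: prior_on_measurable[OF G continuous_on_joint_density])
    then show "(\<lambda>k. likelihood G (Y k)) \<longlonglongrightarrow> likelihood G X" by (rule LIMSEQ_offset)
  qed
qed

end


subsection \<open>The union-intersection statistics\<close>

lemma subvec_component: "subvec a x $ i = (if i \<in> a then x $ i else 0)"
  by (simp add: subvec_def)

lemma subvec_id: "(\<And>i. i \<notin> a \<Longrightarrow> x $ i = 0) \<Longrightarrow> subvec a x = x"
  by (simp add: vec_eq_iff subvec_def)

lemma block_mult_vec: "block a b A *v x = subvec a (A *v subvec b x)"
  by (auto simp: vec_eq_iff matrix_vector_mult_def block_def subvec_def intro!: sum.cong)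

lemma block_fill_mult_vec:
  "(block a a A + block (- a) (- a) (mat 1)) *v x = subvec a (A *v subvec a x) + subvec (- a) x"
  for A :: "real^'p^'p"
  by (auto simp: matrix_vector_mult_add_rdistrib block_mult_vec vec_eq_iff subvec_def)

lemma inner_subvec_disjoint:
  fixes x y :: "real^'p"
  assumes "\<And>i. i \<notin> a \<Longrightarrow> x $ i = 0" "\<And>i. i \<in> a \<Longrightarrow> y $ i = 0"
  shows "x \<bullet> y = 0"
  unfolding inner_vec_def using assms by (intro sum.neutral) force

text \<open>Nonsingularity of the block on \<open>a \<times> a\<close>, phrased through padded
  vectors. Besides positive definite matrices it must cover \<open>cond_cov a X\<close>, which is
  zero outside \<open>a \<times> a\<close>.\<close>

definition block_regular :: "'p set \<Rightarrow> real^'p^'p \<Rightarrow> bool" where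
  "block_regular a A \<longleftrightarrow> (\<forall>x. (\<forall>i. i \<notin> a \<longrightarrow> x $ i = 0) \<longrightarrow> (\<forall>i\<in>a. (A *v x) $ i = 0) \<longrightarrow> x = 0)"

lemma pos_def_quad_le_0: "A \<in> pos_def_matrices \<Longrightarrow> x \<bullet> (A *v x) \<le> 0 \<Longrightarrow> x = 0"
  unfolding pos_def_matrices_def by (simp add: not_le[symmetric]) blast

lemma pos_def_block_regular:
  assumes "A \<in> pos_def_matrices"
  shows "block_regular a A"
  unfolding block_regular_def
proof (intro allI impI)
  fix x assume "\<forall>i. i \<notin> a \<longrightarrow> x $ i = 0" "\<forall>i\<in>a. (A *v x) $ i = 0"
  then have "x \<bullet> (A *v x) = 0" by (intro inner_subvec_disjoint[of a]) auto
  then show "x = 0" using pos_def_quad_le_0[OF assms] by simp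
qed

text \<open>The filled-up system separates: off \<open>a\<close> it reads \<open>x $ i = 0\<close>,
  and on \<open>a\<close> it is then the system of the block alone.\<close>

lemma block_regular_det:
  fixes A :: "real^'p^'p"
  assumes "block_regular a A"
  shows "det (block a a A + block (- a) (- a) (mat 1)) \<noteq> 0"
proof (rule det_nonzeroI)
  fix x assume "(block a a A + block (- a) (- a) (mat 1)) *v x = 0"
  then have eq: "subvec a (A *v subvec a x) + subvec (- a) x = 0" by (simp add: block_fill_mult_vec)
  have out: "x $ i = 0" if "i \<notin> a" for i
    using arg_cong[OF eq, of "\<lambda>v. v $ i"] that by (simp add: subvec_component)
  moreover have "(A *v x) $ i = 0" if "i \<in> a" for i
    using arg_cong[OF eq, of "\<lambda>v. v $ i"] that by (simp add: subvec_component subvec_id[OF out])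
  ultimately show "x = 0" using assms unfolding block_regular_def by blast
qed

text \<open>Lets padded inverses be computed by solving a linear system, without ever unfolding
  \<open>matrix_inv\<close>. The next lemma is its counterpart for the solution itself.\<close>

lemma block_inv_mult_eqI:
  fixes A :: "real^'p^'p"
  assumes r: "block_regular a A"
    and w: "\<And>i. i \<notin> a \<Longrightarrow> w $ i = 0" "\<And>i. i \<in> a \<Longrightarrow> (A *v w) $ i = m $ i"
  shows "block_inv a A *v subvec a m = w"
proof -
  let ?E = "block a a A + block (- a) (- a) (mat 1)"
  have "?E *v w = subvec a m"
    using w by (auto simp: block_fill_mult_vec subvec_id vec_eq_iff subvec_component)
  then have "matrix_inv ?E *v subvec a m = w" by (rule matrix_inv_mult_eqI[OF block_regular_det[OF r]])
  moreover have "subvec a (subvec a m) = subvec a m" by (rule subvec_id) (simp add: subvec_component)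
  ultimately show ?thesis
    by (simp add: block_inv_def block_mult_vec subvec_id w)
qed

lemma block_inv_mult_solves:
  fixes A :: "real^'p^'p"
  assumes r: "block_regular a A"
  defines "w \<equiv> \<lambda>m. block_inv a A *v subvec a m"
  shows "i \<notin> a \<Longrightarrow> w m $ i = 0" and "i \<in> a \<Longrightarrow> (A *v w m) $ i = m $ i"
proof -
  let ?E = "block a a A + block (- a) (- a) (mat 1)"
  define v where "v = matrix_inv ?E *v subvec a m"
  have "?E *v v = subvec a m" unfolding v_def by (rule mult_vec_matrix_inv[OF block_regular_det[OF r]])
  then have eq: "subvec a (A *v subvec a v) + subvec (- a) v = subvec a m" by (simp add: block_fill_mult_vec)
  have out: "v $ i = 0" if "i \<notin> a" for i
    using arg_cong[OF eq, of "\<lambda>v. v $ i"] that by (simp add: subvec_component)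
  have ins: "(A *v v) $ i = m $ i" if "i \<in> a" for i
    using arg_cong[OF eq, of "\<lambda>v. v $ i"] that by (simp add: subvec_component subvec_id[OF out])
  have "w m = v" unfolding w_def by (intro block_inv_mult_eqI r out ins)
  then show "i \<notin> a \<Longrightarrow> w m $ i = 0" and "i \<in> a \<Longrightarrow> (A *v w m) $ i = m $ i"
    using out ins by auto
qed

definition hotelling :: "real^'p^'n \<Rightarrow> real" where
  "hotelling X = real CARD('n) * (sample_mean X \<bullet> (matrix_inv (sample_cov X) *v sample_mean X))"

text \<open>The vector whose signs off \<open>a\<close> are tested in \<open>cone_event\<close>;
  together with \<open>cond_mean\<close> it forms the decomposition of the mean used below.\<close>

definition cond_coeff :: "'p set \<Rightarrow> real^'p^'n \<Rightarrow> real^'p" where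
  "cond_coeff a X = block_inv (- a) (sample_cov X) *v subvec (- a) (sample_mean X)"

lemma cone_event_iff:
  "cone_event a X \<longleftrightarrow> (\<forall>i\<in>a. 0 < cond_mean a X $ i) \<and> (\<forall>i\<in>- a. cond_coeff a X $ i \<le> 0)"
  by (simp add: cone_event_def cond_coeff_def)

context
  fixes X :: "real^'p^'n" and S
  assumes n: "1 < CARD('n)" and d: "det (sample_cov X) \<noteq> 0"
  defines "S \<equiv> sample_cov X"
begin

lemma pos_def_S: "S \<in> pos_def_matrices" unfolding S_def by (rule pos_def_sample_cov[OF n d])

lemma cond_coeff:
  "i \<in> a \<Longrightarrow> cond_coeff a X $ i = 0"
  "i \<notin> a \<Longrightarrow> (S *v cond_coeff a X) $ i = sample_mean X $ i"
  using block_inv_mult_solves[OF pos_def_block_regular[OF pos_def_S], of _ "- a" "sample_mean X"]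
  by (auto simp: cond_coeff_def S_def)

text \<open>The mean splits as \<open>cond_mean + S *v cond_coeff\<close>, with
  \<open>cond_mean\<close> supported on \<open>a\<close> and \<open>cond_coeff\<close> on the
  complement. These complementary supports drive the rest of the section.\<close>

lemma cond_mean_eq: "cond_mean a X = sample_mean X - S *v cond_coeff a X"
proof -
  have "cond_mean a X = subvec a (sample_mean X) - subvec a (S *v subvec (- a) (cond_coeff a X))"
    by (simp add: cond_mean_def cond_coeff_def S_def block_mult_vec)
  also have "subvec (- a) (cond_coeff a X) = cond_coeff a X" by (rule subvec_id) (simp add: cond_coeff)
  finally show ?thesis by (auto simp: vec_eq_iff subvec_component cond_coeff)
qed

lemma cond_mean_outside: "i \<notin> a \<Longrightarrow> cond_mean a X $ i = 0"
  by (simp add: cond_mean_eq cond_coeff)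

lemma cond_coeff_inner_cond_mean: "cond_coeff a X \<bullet> cond_mean b X = (\<Sum>i\<in>b - a. cond_coeff a X $ i * cond_mean b X $ i)"
  unfolding inner_vec_def inner_real_def
  by (rule sum.mono_neutral_right) (auto simp: cond_coeff, metis cond_mean_outside)

text \<open>Uniqueness in a linear complementarity problem: two solutions would give the form of
  \<open>S\<close> at the difference of their coefficients the value
  \<open>?w a \<bullet> ?x b + ?w b \<bullet> ?x a\<close>, which is nonpositive by the sign
  conditions. The set is recovered as the support of \<open>cond_mean\<close>.\<close>

lemma cone_event_unique:
  assumes "cone_event a X" "cone_event b X"
  shows "a = b"
proof -
  let ?w = "\<lambda>a. cond_coeff a X" and ?x = "\<lambda>a. cond_mean a X"
  have le: "?w a \<bullet> ?x b \<le> 0" if "cone_event a X" "cone_event b X" for a b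
    unfolding cond_coeff_inner_cond_mean using that
    by (intro sum_nonpos mult_nonpos_nonneg) (auto simp: cone_event_iff less_imp_le)
  have z: "?w a \<bullet> ?x a = 0" for a by (simp add: cond_coeff_inner_cond_mean)
  have "S *v (?w a - ?w b) = ?x b - ?x a" by (simp add: cond_mean_eq matrix_vector_mult_diff_distrib)
  then have "(?w a - ?w b) \<bullet> (S *v (?w a - ?w b)) = ?w a \<bullet> ?x b + ?w b \<bullet> ?x a"
    using z[of a] z[of b] by (simp add: inner_diff_left inner_diff_right)
  also have "\<dots> \<le> 0" using le[of a b] le[of b a] assms by simp
  finally have "?w a = ?w b"
    using pos_def_quad_le_0[OF pos_def_S, of "?w a - ?w b"] by simp
  then have "?x a = ?x b" by (simp add: cond_mean_eq)
  moreover have "i \<in> a \<longleftrightarrow> ?x a $ i \<noteq> 0" if "cone_event a X" for a i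
    using that cond_mean_outside[of i a] by (auto simp: cone_event_iff)
  ultimately show ?thesis using assms by (metis set_eqI)
qed

text \<open>The inverse of a Schur complement is a block of the full inverse, stated here only for
  the vector \<open>cond_mean a X\<close>.\<close>

lemma block_inv_cond_cov:
  "block_regular a (cond_cov a X)"
  "block_inv a (cond_cov a X) *v cond_mean a X = subvec a (matrix_inv S *v cond_mean a X)"
proof -
  \<comment> \<open>For \<open>u\<close> supported on \<open>a\<close>, \<open>u - t u\<close> is
    the correction for which \<open>S *v (u - t u)\<close> vanishes off \<open>a\<close>; on such
    \<open>u\<close> the Schur complement acts as \<open>S\<close> on the corrected vector.\<close>
  define t where "t u = block_inv (- a) S *v subvec (- a) (S *v u)" for u
  have t: "i \<in> a \<Longrightarrow> t u $ i = 0" "i \<notin> a \<Longrightarrow> (S *v t u) $ i = (S *v u) $ i" for i u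
    using block_inv_mult_solves[OF pos_def_block_regular[OF pos_def_S], of _ "- a"] by (auto simp: t_def)
  have C: "cond_cov a X *v u = S *v (u - t u)" if u: "\<And>i. i \<notin> a \<Longrightarrow> u $ i = 0" for u
  proof -
    have "cond_cov a X *v u = subvec a (S *v u) - subvec a (S *v subvec (- a) (t u))"
      by (simp add: cond_cov_def matrix_vector_mult_diff_rdistrib block_mult_vec S_def t_def subvec_id[OF u]
          matrix_vector_mul_assoc[symmetric])
    also have "subvec (- a) (t u) = t u" by (rule subvec_id) (simp add: t)
    finally show ?thesis by (auto simp: vec_eq_iff subvec_component matrix_vector_mult_diff_distrib t)
  qed
  have dS: "det S \<noteq> 0" using d by (simp add: S_def)
  show reg: "block_regular a (cond_cov a X)"
    unfolding block_regular_def
  proof (intro allI impI)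
    fix u assume u: "\<forall>i. i \<notin> a \<longrightarrow> u $ i = 0" and 0: "\<forall>i\<in>a. (cond_cov a X *v u) $ i = 0"
    have "(S *v (u - t u)) $ i = 0" for i
      using 0 t(2)[of i u] C[of u] u by (cases "i \<in> a") (auto simp: matrix_vector_mult_diff_distrib)
    then have "S *v (u - t u) = 0" by (simp add: vec_eq_iff)
    then have "u - t u = 0" using mult_vec_matrix_inv(2)[OF dS, of "u - t u"] by simp
    then have "u $ i = t u $ i" for i by simp
    then show "u = 0" using u t(1)[of _ u] by (metis vec_eq_iff zero_index)
  qed
  define g where "g = matrix_inv S *v cond_mean a X"
  have Sg: "S *v g = cond_mean a X" by (simp add: g_def mult_vec_matrix_inv[OF dS])
  have dec: "g = subvec a g + subvec (- a) g" by (simp add: vec_eq_iff subvec_component)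
  have Sdec: "S *v subvec (- a) g = cond_mean a X - S *v subvec a g"
    using Sg arg_cong[OF dec, of "\<lambda>v. S *v v"] by (simp add: matrix_vector_right_distrib algebra_simps)
  \<comment> \<open>Since \<open>S *v g\<close> vanishes off \<open>a\<close>, the part of
    \<open>g\<close> off \<open>a\<close> is already the correction of its part on
    \<open>a\<close>.\<close>
  have "t (subvec a g) = - subvec (- a) g"
    unfolding t_def
  proof (rule block_inv_mult_eqI[OF pos_def_block_regular[OF pos_def_S]])
    have "S *v (- v) = - (S *v v)" for v :: "real^'p"
      using matrix_vector_mult_scaleR[of S "-1" v] by simp
    then show "(S *v (- subvec (- a) g)) $ i = (S *v subvec a g) $ i" if "i \<in> - a" for i
      using that by (simp add: Sdec cond_mean_outside)
  qed (simp add: subvec_component)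
  then have "cond_cov a X *v subvec a g = cond_mean a X"
    using dec by (subst C) (auto simp: subvec_component Sg)
  moreover have "subvec a (cond_mean a X) = cond_mean a X" by (rule subvec_id) (rule cond_mean_outside)
  ultimately show "block_inv a (cond_cov a X) *v cond_mean a X = subvec a (matrix_inv S *v cond_mean a X)"
    using block_inv_mult_eqI[OF reg, of "subvec a g" "cond_mean a X"]
    by (simp add: subvec_component g_def)
qed

text \<open>Pythagoras for the inner product of the inverse of \<open>S\<close>: the summands of the
  mean, \<open>cond_mean\<close> and \<open>S *v cond_coeff\<close>, are orthogonal there because
  their supports are complementary.\<close>

lemma hotelling_decomp:
  "hotelling X = cond_quad a X + real CARD('n) * (cond_coeff a X \<bullet> (S *v cond_coeff a X))"
proof -
  let ?x = "cond_mean a X" and ?w = "cond_coeff a X"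
  have dS: "det S \<noteq> 0" using d by (simp add: S_def)
  have sS: "transpose S = S" by (simp add: S_def transpose_sample_cov)
  have m: "sample_mean X = ?x + S *v ?w" by (simp add: cond_mean_eq)
  have x0: "?x \<bullet> ?w = 0" by (intro inner_subvec_disjoint[of a]) (simp_all add: cond_mean_outside cond_coeff)
  have "?x \<bullet> subvec (- a) (matrix_inv S *v ?x) = 0"
    by (intro inner_subvec_disjoint[of a]) (simp_all add: cond_mean_outside subvec_component)
  moreover have "matrix_inv S *v ?x = subvec a (matrix_inv S *v ?x) + subvec (- a) (matrix_inv S *v ?x)"
    by (simp add: vec_eq_iff subvec_component)
  ultimately have q: "?x \<bullet> (block_inv a (cond_cov a X) *v ?x) = ?x \<bullet> (matrix_inv S *v ?x)"
    by (metis add.right_neutral block_inv_cond_cov(2) inner_add_right)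
  have "(S *v ?w) \<bullet> (matrix_inv S *v ?x) = ?w \<bullet> ?x"
    by (metis dS inner_symmetric_matrix mult_vec_matrix_inv(1) sS)
  then have "sample_mean X \<bullet> (matrix_inv S *v sample_mean X)
      = ?x \<bullet> (matrix_inv S *v ?x) + ?w \<bullet> (S *v ?w)"
    unfolding m matrix_vector_right_distrib mult_vec_matrix_inv[OF dS] using x0
    by (simp add: inner_add_left inner_add_right inner_commute)
  then show ?thesis by (simp add: hotelling_def cond_quad_def q S_def[symmetric] algebra_simps)
qed

lemma cond_UNIV: "cond_coeff UNIV X = 0" "cond_mean UNIV X = sample_mean X" "cond_quad UNIV X = hotelling X"
proof -
  show 0: "cond_coeff UNIV X = 0" by (simp add: vec_eq_iff cond_coeff)
  show "cond_mean UNIV X = sample_mean X" "cond_quad UNIV X = hotelling X"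
    using hotelling_decomp[of UNIV] by (simp_all add: cond_mean_eq 0)
qed

text \<open>With one coordinate removed the inverted block is the single number
  \<open>S $ r $ r\<close>, so all conditional quantities become explicit.\<close>

lemma cond_single:
  shows "cond_coeff (- {r}) X = axis r (sample_mean X $ r / S $ r $ r)"
    and "cond_mean (- {r}) X $ i = sample_mean X $ i - S $ i $ r * (sample_mean X $ r / S $ r $ r)"
    and "cond_quad (- {r}) X = hotelling X - real CARD('n) * (sample_mean X $ r)\<^sup>2 / S $ r $ r"
    and "0 < S $ r $ r"
proof -
  let ?c = "cond_coeff (- {r}) X $ r"
  have w: "cond_coeff (- {r}) X = axis r ?c" by (auto simp: vec_eq_iff axis_def cond_coeff)
  have Sw: "(S *v axis r c) $ i = S $ i $ r * c" for i c
    by (simp add: matrix_vector_mult_def axis_def if_distrib cong: if_cong)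
  have "0 < axis r 1 \<bullet> (S *v axis r 1)"
    using pos_def_S unfolding pos_def_matrices_def by (simp add: axis_eq_0_iff)
  then show pos: "0 < S $ r $ r" by (simp add: inner_axis' Sw)
  have "(S *v axis r ?c) $ r = sample_mean X $ r"
    unfolding w[symmetric] by (rule cond_coeff(2)) simp
  then have "S $ r $ r * ?c = sample_mean X $ r" by (simp add: Sw)
  then have c: "?c = sample_mean X $ r / S $ r $ r" using pos by (simp add: field_simps)
  show w': "cond_coeff (- {r}) X = axis r (sample_mean X $ r / S $ r $ r)" using w c by simp
  show "cond_mean (- {r}) X $ i = sample_mean X $ i - S $ i $ r * (sample_mean X $ r / S $ r $ r)"
    by (simp add: cond_mean_eq w' Sw)
  show "cond_quad (- {r}) X = hotelling X - real CARD('n) * (sample_mean X $ r)\<^sup>2 / S $ r $ r"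
    using hotelling_decomp[of "- {r}"] pos
    by (simp add: w' inner_axis' Sw power2_eq_square)
qed

lemma uit_orthant_eq:
  assumes "cone_event a X"
  shows "uit_orthant X = cond_quad a X"
proof -
  have "uit_orthant X = (\<Sum>b\<in>Pow UNIV. if b = a then cond_quad a X else 0)"
    unfolding uit_orthant_def
  proof (intro sum.cong refl)
    fix b
    show "cond_quad b X * of_bool (cone_event b X) = (if b = a then cond_quad a X else 0)"
      using assms cone_event_unique[OF assms, of b] by (cases "b = a") auto
  qed
  then show ?thesis by simp
qed

lemma uit_orthant_interior:
  assumes "\<And>i. 0 < sample_mean X $ i"
  shows "uit_orthant X = hotelling X"
  using assms uit_orthant_eq[of UNIV] by (simp add: cone_event_iff cond_UNIV)

text \<open>The two hypotheses are \<open>cone_event (- {r}) X\<close> written out, so the sum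
  reduces to that one term.\<close>

lemma uit_orthant_facet:
  assumes "sample_mean X $ r \<le> 0"
    and "\<And>i. i \<noteq> r \<Longrightarrow> 0 < sample_mean X $ i - S $ i $ r * (sample_mean X $ r / S $ r $ r)"
  shows "uit_orthant X = hotelling X - real CARD('n) * (sample_mean X $ r)\<^sup>2 / S $ r $ r"
proof -
  have "cone_event (- {r}) X"
    using assms divide_nonpos_pos[OF assms(1) cond_single(4)]
    unfolding cone_event_iff cond_single(1) cond_single(2) by (simp add: axis_def)
  then show ?thesis using uit_orthant_eq cond_single(3) by simp
qed

end

lemma uit_halfspace_interior:
  fixes X :: "real^('p::{finite,linorder})^'n"
  shows "0 < sample_mean X $ Max UNIV \<Longrightarrow> uit_halfspace X = hotelling X"
  by (simp add: uit_halfspace_def hotelling_def)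

lemma uit_halfspace_facet:
  fixes X :: "real^('p::{finite,linorder})^'n"
  assumes "1 < CARD('n)" "det (sample_cov X) \<noteq> 0" "sample_mean X $ Max UNIV \<le> 0"
  shows "uit_halfspace X =
    hotelling X - real CARD('n) * (sample_mean X $ Max UNIV)\<^sup>2 / sample_cov X $ Max UNIV $ Max UNIV"
  using assms cond_single(3)[OF assms(1,2), of "Max UNIV"]
  by (simp add: uit_halfspace_def Compl_eq_Diff_UNIV)


subsection \<open>Samples with prescribed mean and second moment\<close>

text \<open>Exhibits the exponent as an affine function of the raw second moment and the mean. At
  \<theta> = 0 only the second moment remains.\<close>

lemma residual_quad_expand:
  fixes X :: "real^'p^'n"
  assumes "transpose \<Lambda> = \<Lambda>"
  shows "residual_quad \<theta> \<Lambda> X = (\<Sum>i\<in>UNIV. \<Sum>j\<in>UNIV. \<Lambda> $ i $ j * (\<Sum>k\<in>UNIV. X $ k $ i * X $ k $ j))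
    - 2 * real CARD('n) * (\<theta> \<bullet> (\<Lambda> *v sample_mean X)) + real CARD('n) * (\<theta> \<bullet> (\<Lambda> *v \<theta>))"
proof -
  have "(x - \<theta>) \<bullet> (\<Lambda> *v (x - \<theta>)) = x \<bullet> (\<Lambda> *v x) - 2 * (\<theta> \<bullet> (\<Lambda> *v x)) + \<theta> \<bullet> (\<Lambda> *v \<theta>)" for x
    using inner_symmetric_matrix[OF assms, of x \<theta>]
    by (simp add: matrix_vector_mult_diff_distrib inner_diff_left inner_diff_right inner_commute)
  then have "residual_quad \<theta> \<Lambda> X = (\<Sum>k\<in>UNIV. X $ k \<bullet> (\<Lambda> *v X $ k))
    - 2 * (\<Sum>k\<in>UNIV. \<theta> \<bullet> (\<Lambda> *v X $ k)) + real CARD('n) * (\<theta> \<bullet> (\<Lambda> *v \<theta>))"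
    by (simp add: residual_quad_def sum.distrib sum_subtractf sum_distrib_left)
  moreover have "(\<Sum>k\<in>UNIV. \<theta> \<bullet> (\<Lambda> *v X $ k)) = real CARD('n) * (\<theta> \<bullet> (\<Lambda> *v sample_mean X))"
  proof -
    have "(\<Sum>k\<in>UNIV. \<theta> \<bullet> (\<Lambda> *v X $ k)) = (transpose \<Lambda> *v \<theta>) \<bullet> (\<Sum>k\<in>UNIV. X $ k)"
      by (simp add: inner_mult_transpose inner_sum_right)
    also have "\<dots> = \<theta> \<bullet> (\<Lambda> *v (real CARD('n) *\<^sub>R sample_mean X))"
      by (simp add: inner_mult_transpose sample_mean_def)
    finally show ?thesis by (simp add: matrix_vector_mult_scaleR)
  qed
  moreover have "(\<Sum>k\<in>UNIV. X $ k \<bullet> (\<Lambda> *v X $ k))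
      = (\<Sum>i\<in>UNIV. \<Sum>j\<in>UNIV. \<Lambda> $ i $ j * (\<Sum>k\<in>UNIV. X $ k $ i * X $ k $ j))"
  proof -
    have "(\<Sum>k\<in>UNIV. X $ k \<bullet> (\<Lambda> *v X $ k))
        = (\<Sum>k\<in>UNIV. \<Sum>i\<in>UNIV. \<Sum>j\<in>UNIV. \<Lambda> $ i $ j * (X $ k $ i * X $ k $ j))"
      by (simp add: inner_vec_def matrix_vector_mult_def sum_distrib_left mult_ac)
    also have "\<dots> = (\<Sum>i\<in>UNIV. \<Sum>k\<in>UNIV. \<Sum>j\<in>UNIV. \<Lambda> $ i $ j * (X $ k $ i * X $ k $ j))"
      by (rule sum.swap)
    also have "\<dots> = (\<Sum>i\<in>UNIV. \<Sum>j\<in>UNIV. \<Sum>k\<in>UNIV. \<Lambda> $ i $ j * (X $ k $ i * X $ k $ j))"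
      by (intro sum.cong refl sum.swap)
    finally show ?thesis by (simp add: sum_distrib_left)
  qed
  ultimately show ?thesis by simp
qed

lemma sample_cov_component:
  fixes X :: "real^'p^'n"
  shows "sample_cov X $ i $ j = ((\<Sum>k\<in>UNIV. X $ k $ i * X $ k $ j)
    - real CARD('n) * sample_mean X $ i * sample_mean X $ j) / (real CARD('n) - 1)"
proof -
  let ?m = "sample_mean X"
  have s: "(\<Sum>k\<in>UNIV. X $ k $ i) = real CARD('n) * ?m $ i" for i
    by (simp add: sample_mean_def)
  have "(\<Sum>k\<in>UNIV. (X $ k - ?m) $ i * (X $ k - ?m) $ j) = (\<Sum>k\<in>UNIV. X $ k $ i * X $ k $ j)
      - ?m $ j * (\<Sum>k\<in>UNIV. X $ k $ i) - ?m $ i * (\<Sum>k\<in>UNIV. X $ k $ j) + real CARD('n) * ?m $ i * ?m $ j"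
    by (simp add: algebra_simps sum.distrib sum_subtractf sum_distrib_left)
  then show ?thesis by (simp add: sample_cov_def s field_simps)
qed

text \<open>The hyperplane orthogonal to the all-ones vector has dimension
  \<open>CARD('n) - 1\<close>, leaving room for \<open>CARD('p)\<close> orthonormal vectors
  \<open>b i\<close>. The vector \<open>z k\<close> collects their entries at
  \<open>k\<close>.\<close>

lemma orthonormal_contrasts:
  assumes "CARD('p) < CARD('n)"
  obtains z :: "'n::finite \<Rightarrow> real^'p"
  where "(\<Sum>k\<in>UNIV. z k) = 0" and "\<And>u v. (\<Sum>k\<in>UNIV. (u \<bullet> z k) * (v \<bullet> z k)) = u \<bullet> v"
proof -
  let ?H = "{x :: real^'n. 1 \<bullet> x = 0}"
  have one: "(1 :: real^'n) \<noteq> 0" by (simp add: vec_eq_iff)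
  have "dim ?H = CARD('n) - 1" using dim_hyperplane[OF one] by simp
  obtain B where B: "B \<subseteq> ?H" "pairwise orthogonal B" "\<And>x. x \<in> B \<Longrightarrow> norm x = 1" "independent B" "card B = dim ?H"
    using orthonormal_basis_subspace[OF subspace_hyperplane[of "1 :: real^'n"]] by metis
  have "finite B" using B(4) independent_imp_finite by blast
  moreover have "card (UNIV :: 'p set) \<le> card B" using assms B(5) \<open>dim ?H = _\<close> by simp
  ultimately obtain b :: "'p \<Rightarrow> real^'n" where b: "inj b" "range b \<subseteq> B"
    by (metis card_le_inj finite_class.finite_UNIV)
  have bb: "b i \<bullet> b j = (if i = j then 1 else 0)" for i j
  proof (cases "i = j")
    case True
    moreover have "norm (b j) = 1" using b by (intro B(3)) auto
    ultimately show ?thesis by (simp add: dot_square_norm)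
  next
    case False
    then have "orthogonal (b i) (b j)" using B(2) b by (intro pairwiseD[OF B(2)]) (auto dest: injD)
    then show ?thesis using False by (simp add: orthogonal_def)
  qed
  define z where "z k = (\<chi> i. b i $ k)" for k
  show ?thesis
  proof
    have "(\<Sum>k\<in>UNIV. b i $ k) = 0" for i
      using B(1) b(2) by (auto simp: inner_vec_def)
    then show "(\<Sum>k\<in>UNIV. z k) = 0" by (simp add: z_def vec_eq_iff)
    fix u v :: "real^'p"
    have "(\<Sum>k\<in>UNIV. (u \<bullet> z k) * (v \<bullet> z k))
        = (\<Sum>k\<in>UNIV. \<Sum>i\<in>UNIV. \<Sum>j\<in>UNIV. u $ i * v $ j * (b i $ k * b j $ k))"
      by (simp add: z_def inner_vec_def sum_product mult_ac)
    also have "\<dots> = (\<Sum>i\<in>UNIV. \<Sum>k\<in>UNIV. \<Sum>j\<in>UNIV. u $ i * v $ j * (b i $ k * b j $ k))"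
      by (rule sum.swap)
    also have "\<dots> = (\<Sum>i\<in>UNIV. \<Sum>j\<in>UNIV. \<Sum>k\<in>UNIV. u $ i * v $ j * (b i $ k * b j $ k))"
      by (intro sum.cong refl sum.swap)
    also have "\<dots> = (\<Sum>i\<in>UNIV. \<Sum>j\<in>UNIV. u $ i * v $ j * (b i \<bullet> b j))"
      by (simp add: sum_distrib_left inner_vec_def)
    also have "\<dots> = u \<bullet> v" by (simp add: bb inner_vec_def[of u v] if_distrib cong: if_cong)
    finally show "(\<Sum>k\<in>UNIV. (u \<bullet> z k) * (v \<bullet> z k)) = u \<bullet> v" .
  qed
qed

text \<open>
  The coefficient is the root of \<open>N - 2 b + b\<^sup>2 |\<eta>|\<^sup>2 = 0\<close> that stays finite at \<open>\<eta> = 0\<close>; with it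
  \<open>(I - b \<eta> \<eta>')\<^sup>2 = I - N \<eta> \<eta>'\<close>, so that \<open>mk_sample z L \<eta>\<close> has mean \<open>L \<eta>\<close> and raw second moment \<open>L L'\<close>,
  the latter not depending on \<open>\<eta>\<close>.
\<close>

definition shrink :: "real \<Rightarrow> real^'p \<Rightarrow> real" where
  "shrink N \<eta> = N / (1 + sqrt (1 - N * (\<eta> \<bullet> \<eta>)))"

definition mk_sample :: "('n::finite \<Rightarrow> real^'p) \<Rightarrow> real^'p^'p \<Rightarrow> real^'p \<Rightarrow> real^'p^'n" where
  "mk_sample z L \<eta> = (\<chi> k. L *v (\<eta> + z k - (shrink (real CARD('n)) \<eta> * (\<eta> \<bullet> z k)) *\<^sub>R \<eta>))"

lemma shrink_eq:
  assumes "N * (\<eta> \<bullet> \<eta>) < 1"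
  shows "N - 2 * shrink N \<eta> + (shrink N \<eta>)\<^sup>2 * (\<eta> \<bullet> \<eta>) = 0"
proof -
  define s where "s = sqrt (1 - N * (\<eta> \<bullet> \<eta>))"
  have s: "0 \<le> s" "s\<^sup>2 = 1 - N * (\<eta> \<bullet> \<eta>)" using assms by (simp_all add: s_def)
  \<comment> \<open>The extra factor \<open>N\<close> makes
    \<open>N * (\<eta> \<bullet> \<eta>)\<close> appear, which factors as
    \<open>(1 + s) * (1 - s)\<close>. The case \<open>N = 0\<close> is recovered at the end, where
    \<open>shrink\<close> is zero.\<close>
  have "N * (N - 2 * shrink N \<eta> + (shrink N \<eta>)\<^sup>2 * (\<eta> \<bullet> \<eta>)) = N\<^sup>2 * (1 - 2 / (1 + s) + (N * (\<eta> \<bullet> \<eta>)) / (1 + s)\<^sup>2)"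
    by (simp add: shrink_def s_def[symmetric] power_divide power2_eq_square algebra_simps)
  also have "N * (\<eta> \<bullet> \<eta>) = (1 + s) * (1 - s)" using s(2) by (simp add: power2_eq_square algebra_simps)
  also have "1 - 2 / (1 + s) + (1 + s) * (1 - s) / (1 + s)\<^sup>2 = 0"
  proof -
    have "(1 + s) * (1 - s) / (1 + s)\<^sup>2 = (1 - s) / (1 + s)" using s(1) by (simp add: power2_eq_square)
    then show ?thesis using s(1) by (simp add: field_simps)
  qed
  finally have "N = 0 \<or> ?thesis" by simp
  then show ?thesis by (auto simp: shrink_def)
qed

context
  fixes z :: "'n::finite \<Rightarrow> real^'p" and L :: "real^'p^'p" and \<eta> :: "real^'p"
  assumes n: "1 < CARD('n)"
    and z0: "(\<Sum>k\<in>UNIV. z k) = 0" and zz: "\<And>u v. (\<Sum>k\<in>UNIV. (u \<bullet> z k) * (v \<bullet> z k)) = u \<bullet> v"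
    and \<eta>: "real CARD('n) * (\<eta> \<bullet> \<eta>) < 1"
begin

lemma sample_mean_mk_sample: "sample_mean (mk_sample z L \<eta>) = L *v \<eta>"
proof -
  let ?N = "real CARD('n)" and ?b = "shrink (real CARD('n)) \<eta>"
  have "(\<Sum>k\<in>UNIV. \<eta> + z k - (?b * (\<eta> \<bullet> z k)) *\<^sub>R \<eta>) = ?N *\<^sub>R \<eta>"
  proof -
    have "(\<Sum>k\<in>UNIV. (?b * (\<eta> \<bullet> z k)) *\<^sub>R \<eta>) = (?b * (\<eta> \<bullet> (\<Sum>k\<in>UNIV. z k))) *\<^sub>R \<eta>"
      by (simp add: inner_sum_right sum_distrib_left scaleR_sum_left)
    then show ?thesis by (simp add: sum.distrib sum_subtractf z0 sum_constant_scaleR del: sum_constant)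
  qed
  moreover have "(\<Sum>k\<in>UNIV. mk_sample z L \<eta> $ k) = L *v (\<Sum>k\<in>UNIV. \<eta> + z k - (?b * (\<eta> \<bullet> z k)) *\<^sub>R \<eta>)"
    by (simp add: mk_sample_def linear_sum[OF matrix_vector_mul_linear])
  ultimately show ?thesis by (simp add: sample_mean_def matrix_vector_mult_scaleR)
qed

lemma raw_moment_mk_sample:
  "(\<Sum>k\<in>UNIV. mk_sample z L \<eta> $ k $ i * mk_sample z L \<eta> $ k $ j) = L $ i \<bullet> L $ j"
proof -
  let ?N = "real CARD('n)" and ?b = "shrink (real CARD('n)) \<eta>"
  define \<zeta> where "\<zeta> k = \<eta> + z k - (?b * (\<eta> \<bullet> z k)) *\<^sub>R \<eta>" for k
  have "(\<Sum>k\<in>UNIV. (u \<bullet> \<zeta> k) * (v \<bullet> \<zeta> k)) = u \<bullet> v" for u v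
  proof -
    \<comment> \<open>The matrix \<open>I - b \<eta> \<eta>'\<close> is symmetric and is moved here
      from \<open>z k\<close> to the test vectors \<open>u\<close> and \<open>v\<close>.\<close>
    define u' where "u' = u - (?b * (u \<bullet> \<eta>)) *\<^sub>R \<eta>"
    define v' where "v' = v - (?b * (v \<bullet> \<eta>)) *\<^sub>R \<eta>"
    have "u \<bullet> \<zeta> k = u \<bullet> \<eta> + u' \<bullet> z k" "v \<bullet> \<zeta> k = v \<bullet> \<eta> + v' \<bullet> z k" for k
      by (simp_all add: \<zeta>_def u'_def v'_def inner_add_right inner_diff_left inner_diff_right)
    then have "(\<Sum>k\<in>UNIV. (u \<bullet> \<zeta> k) * (v \<bullet> \<zeta> k)) = (\<Sum>k\<in>UNIV. (u \<bullet> \<eta>) * (v \<bullet> \<eta>) + (u \<bullet> \<eta>) * (v' \<bullet> z k)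
        + (v \<bullet> \<eta>) * (u' \<bullet> z k) + (u' \<bullet> z k) * (v' \<bullet> z k))"
      by (simp add: algebra_simps)
    also have "\<dots> = ?N * ((u \<bullet> \<eta>) * (v \<bullet> \<eta>)) + (u \<bullet> \<eta>) * (v' \<bullet> (\<Sum>k\<in>UNIV. z k))
        + (v \<bullet> \<eta>) * (u' \<bullet> (\<Sum>k\<in>UNIV. z k)) + u' \<bullet> v'"
      by (simp add: sum.distrib zz inner_sum_right sum_distrib_left)
    also have "u' \<bullet> v' = u \<bullet> v - 2 * ?b * ((u \<bullet> \<eta>) * (v \<bullet> \<eta>)) + ?b\<^sup>2 * (\<eta> \<bullet> \<eta>) * ((u \<bullet> \<eta>) * (v \<bullet> \<eta>))"
      by (simp add: u'_def v'_def inner_diff_left inner_diff_right inner_commute power2_eq_square algebra_simps)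
    finally have "(\<Sum>k\<in>UNIV. (u \<bullet> \<zeta> k) * (v \<bullet> \<zeta> k)) =
        u \<bullet> v + (?N - 2 * ?b + ?b\<^sup>2 * (\<eta> \<bullet> \<eta>)) * ((u \<bullet> \<eta>) * (v \<bullet> \<eta>))"
      by (simp add: z0 algebra_simps)
    then show ?thesis by (simp add: shrink_eq[OF \<eta>])
  qed
  then show ?thesis
    by (simp add: mk_sample_def \<zeta>_def[symmetric] matrix_vector_mul_component)
qed

lemma sample_cov_mk_sample:
  "sample_cov (mk_sample z L \<eta>) $ i $ j =
    (L $ i \<bullet> L $ j - real CARD('n) * (L *v \<eta>) $ i * (L *v \<eta>) $ j) / (real CARD('n) - 1)"
  by (simp add: sample_cov_component raw_moment_mk_sample sample_mean_mk_sample)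

text \<open>In matrix form, \<open>(N - 1) S = L (I - N \<eta> \<eta>') L'\<close> for
  \<open>N\<close> observations: a rank-one perturbation that can be inverted by hand.\<close>

lemma sample_cov_mk_sample_mult:
  "sample_cov (mk_sample z L \<eta>) *v x = (1 / (real CARD('n) - 1)) *\<^sub>R
    (L *v (transpose L *v x - (real CARD('n) * (\<eta> \<bullet> (transpose L *v x))) *\<^sub>R \<eta>))"
proof (subst vec_eq_iff, intro allI)
  fix i
  let ?N = "real CARD('n)"
  have "(sample_cov (mk_sample z L \<eta>) *v x) $ i = (\<Sum>j\<in>UNIV. (L $ i \<bullet> L $ j) * x $ j
      - ?N * (L *v \<eta>) $ i * ((L *v \<eta>) $ j * x $ j)) / (?N - 1)"
    by (simp add: matrix_vector_mult_def[of "sample_cov _"] sample_cov_mk_sample sum_divide_distrib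
        right_diff_distrib left_diff_distrib mult_ac)
  also have "\<dots> = ((\<Sum>j\<in>UNIV. (L $ i \<bullet> L $ j) * x $ j) - ?N * (L *v \<eta>) $ i * ((L *v \<eta>) \<bullet> x)) / (?N - 1)"
    by (simp add: sum_subtractf sum_distrib_left inner_vec_def[of "L *v \<eta>"])
  also have "(\<Sum>j\<in>UNIV. (L $ i \<bullet> L $ j) * x $ j) = (L *v (transpose L *v x)) $ i"
  proof -
    have "transpose L *v x = (\<Sum>j\<in>UNIV. x $ j *\<^sub>R L $ j)"
      by (simp add: vec_eq_iff matrix_vector_mult_def transpose_def mult_ac)
    then show ?thesis by (simp add: matrix_vector_mul_component inner_sum_right mult_ac)
  qed
  also have "(L *v \<eta>) \<bullet> x = \<eta> \<bullet> (transpose L *v x)"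
    by (simp only: inner_mult_transpose transpose_transpose)
  finally show "(sample_cov (mk_sample z L \<eta>) *v x) $ i = ((1 / (?N - 1)) *\<^sub>R
    (L *v (transpose L *v x - (?N * (\<eta> \<bullet> (transpose L *v x))) *\<^sub>R \<eta>))) $ i"
    by (simp add: matrix_vector_mult_diff_distrib matrix_vector_mult_scaleR)
qed

lemma det_sample_cov_mk_sample:
  assumes L: "det L \<noteq> 0"
  shows "det (sample_cov (mk_sample z L \<eta>)) \<noteq> 0"
proof (rule det_nonzeroI)
  fix x assume 0: "sample_cov (mk_sample z L \<eta>) *v x = 0"
  let ?N = "real CARD('n)" and ?y = "transpose L *v x"
  have Lt: "det (transpose L) \<noteq> 0" using L by simp
  have "L *v (?y - (?N * (\<eta> \<bullet> ?y)) *\<^sub>R \<eta>) = 0"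
    using 0 n by (simp add: sample_cov_mk_sample_mult)
  then have y: "?y = (?N * (\<eta> \<bullet> ?y)) *\<^sub>R \<eta>" using mult_vec_matrix_inv(2)[OF L] by (metis matrix_vector_mult_0_right right_minus_eq)
  have "\<eta> \<bullet> ?y = ?N * (\<eta> \<bullet> \<eta>) * (\<eta> \<bullet> ?y)"
    using arg_cong[OF y, of "\<lambda>v. \<eta> \<bullet> v"] by simp
  then have "\<eta> \<bullet> ?y = 0" using \<eta> by simp
  then have "?y = 0" using y by simp
  then show "x = 0" using mult_vec_matrix_inv(2)[OF Lt] by (metis matrix_vector_mult_0_right)
qed

text \<open>The statistic depends on the length of \<eta> and not on \<open>L\<close>. Hence
  \<open>L\<close> can vary at fixed \<eta> without leaving the surface.\<close>

lemma hotelling_mk_sample: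
  assumes L: "det L \<noteq> 0"
  shows "hotelling (mk_sample z L \<eta>) =
    real CARD('n) * (real CARD('n) - 1) * (\<eta> \<bullet> \<eta>) / (1 - real CARD('n) * (\<eta> \<bullet> \<eta>))"
proof -
  let ?N = "real CARD('n)" and ?X = "mk_sample z L \<eta>"
  \<comment> \<open>Since \<eta> is an eigenvector of \<open>I - N \<eta> \<eta>'\<close> with
    eigenvalue \<open>1 - N (\<eta> \<bullet> \<eta>)\<close>, the equation
    \<open>S *v x = L *v \<eta>\<close> is solved by making \<open>transpose L *v x\<close> a
    multiple of \<eta>.\<close>
  let ?c = "(?N - 1) / (1 - ?N * (\<eta> \<bullet> \<eta>))"
  have Lt: "det (transpose L) \<noteq> 0" using L by simp
  define x where "x = matrix_inv (transpose L) *v (?c *\<^sub>R \<eta>)"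
  have y: "transpose L *v x = ?c *\<^sub>R \<eta>" unfolding x_def by (rule mult_vec_matrix_inv(1)[OF Lt])
  have "?c - ?N * ?c * (\<eta> \<bullet> \<eta>) = ?N - 1"
  proof -
    have "?c - ?N * ?c * (\<eta> \<bullet> \<eta>) = ?c * (1 - ?N * (\<eta> \<bullet> \<eta>))" by (simp only: algebra_simps)
    then show ?thesis using \<eta> by simp
  qed
  moreover have "sample_cov ?X *v x = (1 / (?N - 1)) *\<^sub>R ((?c - ?N * ?c * (\<eta> \<bullet> \<eta>)) *\<^sub>R (L *v \<eta>))"
    unfolding sample_cov_mk_sample_mult y matrix_vector_mult_diff_distrib matrix_vector_mult_scaleR
      inner_scaleR_right scaleR_left_diff_distrib by (simp only: mult.assoc)
  ultimately have "sample_cov ?X *v x = L *v \<eta>" using n by simp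
  then have "matrix_inv (sample_cov ?X) *v (L *v \<eta>) = x"
    by (rule matrix_inv_mult_eqI[OF det_sample_cov_mk_sample[OF L]])
  then have "hotelling ?X = ?N * ((L *v \<eta>) \<bullet> x)"
    by (simp add: hotelling_def sample_mean_mk_sample)
  also have "(L *v \<eta>) \<bullet> x = \<eta> \<bullet> (transpose L *v x)"
    by (simp only: inner_mult_transpose transpose_transpose)
  finally show ?thesis unfolding y by simp
qed

end

lemma continuous_on_mk_sample:
  fixes z :: "'n::finite \<Rightarrow> real^'p"
  assumes "continuous_on T f" "\<And>x. x \<in> T \<Longrightarrow> real CARD('n) * (f x \<bullet> f x) < 1"
  shows "continuous_on T (\<lambda>x. mk_sample z L (f x))"
proof -
  have "1 + sqrt (1 - real CARD('n) * (f x \<bullet> f x)) \<noteq> 0" if "x \<in> T" for x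
  proof -
    have "0 \<le> sqrt (1 - real CARD('n) * (f x \<bullet> f x))" using assms(2)[OF that] by simp
    then show ?thesis by linarith
  qed
  then show ?thesis unfolding mk_sample_def shrink_def
    using assms(1) by (intro continuous_on_vec_lambda continuous_on_matrix_vector_mult continuous_intros) auto
qed

subsection \<open>Analyticity of Laplace transforms\<close>

text \<open>Expand the exponential and exchange sum and integral. Integrability at both
  \<open>t\<close> and \<open>- t\<close> supplies the majorant.\<close>

lemma laplace_transform_power_series:
  fixes w l :: "'a \<Rightarrow> real"
  assumes m: "w \<in> borel_measurable M" "l \<in> borel_measurable M"
    and w: "\<And>x. x \<in> space M \<Longrightarrow> 0 \<le> w x"
    and int: "\<And>t. \<bar>t\<bar> < \<rho> \<Longrightarrow> integrable M (\<lambda>x. w x * exp (t * l x))"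
    and t: "\<bar>t\<bar> < \<rho>"
  shows "(\<lambda>k. (\<integral>x. w x * l x ^ k / fact k \<partial>M) * t ^ k) sums (\<integral>x. w x * exp (t * l x) \<partial>M)"
proof -
  \<comment> \<open>Dominates \<open>w x * exp \<bar>s * l x\<bar>\<close>, since one of the two
    exponentials equals it; this controls all partial sums of absolute values at once.\<close>
  let ?D = "\<lambda>s x. w x * exp (s * l x) + w x * exp (- s * l x)"
  have D: "integrable M (?D s)" if "0 \<le> s" "s < \<rho>" for s
    using that int[of s] int[of "- s"] by simp
  have s: "(\<lambda>k. w x * (\<bar>s * l x\<bar> ^ k / fact k)) sums (w x * exp \<bar>s * l x\<bar>)" for x s
    using exp_converges[of "\<bar>s * l x\<bar>"] by (intro sums_mult) (simp add: divide_inverse mult_ac)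
  have part: "(\<Sum>k\<in>K. w x * (\<bar>s * l x\<bar> ^ k / fact k)) \<le> ?D s x" if "x \<in> space M" "0 \<le> s" "finite K" for x s K
  proof -
    have "(\<Sum>k\<in>K. w x * (\<bar>s * l x\<bar> ^ k / fact k)) \<le> w x * exp \<bar>s * l x\<bar>"
      unfolding sums_unique[OF s] using w[OF that(1)] sums_summable[OF s] that(3) by (intro sum_le_suminf) auto
    also have "\<dots> \<le> ?D s x"
      using w[OF that(1)] by (cases "0 \<le> s * l x") (auto simp: abs_if)
    finally show ?thesis .
  qed
  have abs_eq: "\<bar>w x * l x ^ k / fact k * s ^ k\<bar> = w x * (\<bar>s * l x\<bar> ^ k / fact k)"
    if "x \<in> space M" for x k s
    using w[OF that] by (simp add: abs_mult power_abs power_mult_distrib mult_ac)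
  let ?f = "\<lambda>k x. w x * l x ^ k / fact k"
  have bnd: "integrable M (?D \<bar>t\<bar>)" using D[of "\<bar>t\<bar>"] t by simp
  have int_t: "integrable M (\<lambda>x. ?f k x * t ^ k)" for k
  proof (rule Bochner_Integration.integrable_bound[OF bnd])
    show "AE x in M. norm (?f k x * t ^ k) \<le> norm (?D \<bar>t\<bar> x)"
    proof (rule AE_I2)
      fix x assume x: "x \<in> space M"
      have "norm (?f k x * t ^ k) = (\<Sum>k\<in>{k}. w x * (\<bar>\<bar>t\<bar> * l x\<bar> ^ k / fact k))"
        using abs_eq[OF x, of k t] by (simp add: abs_mult)
      also have "\<dots> \<le> ?D \<bar>t\<bar> x" by (rule part[OF x]) auto
      finally show "norm (?f k x * t ^ k) \<le> norm (?D \<bar>t\<bar> x)" by simp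
    qed
  qed (use m in measurable)
  have sums: "(\<lambda>k. \<integral>x. ?f k x * t ^ k \<partial>M) sums (\<integral>x. (\<Sum>k. ?f k x * t ^ k) \<partial>M)"
  proof (rule sums_integral[OF int_t])
    show "AE x in M. summable (\<lambda>k. norm (?f k x * t ^ k))"
      using sums_summable[OF s[of _ t]] by (intro AE_I2) (simp only: real_norm_def abs_eq)
    show "summable (\<lambda>k. \<integral>x. norm (?f k x * t ^ k) \<partial>M)"
    proof (rule bounded_imp_summable)
      fix K
      have "(\<Sum>k\<le>K. \<integral>x. norm (?f k x * t ^ k) \<partial>M) = (\<integral>x. (\<Sum>k\<le>K. norm (?f k x * t ^ k)) \<partial>M)"
        by (rule Bochner_Integration.integral_sum[symmetric]) (rule integrable_norm[OF int_t])
      also have "\<dots> \<le> (\<integral>x. ?D \<bar>t\<bar> x \<partial>M)"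
      proof (rule integral_mono[OF _ bnd])
        show "integrable M (\<lambda>x. \<Sum>k\<le>K. norm (?f k x * t ^ k))"
          by (intro Bochner_Integration.integrable_sum integrable_norm int_t)
        fix x assume x: "x \<in> space M"
        have "(\<Sum>k\<le>K. norm (?f k x * t ^ k)) = (\<Sum>k\<le>K. w x * (\<bar>\<bar>t\<bar> * l x\<bar> ^ k / fact k))"
          using abs_eq[OF x, of _ t] by (simp add: abs_mult)
        also have "\<dots> \<le> ?D \<bar>t\<bar> x" by (rule part[OF x]) auto
        finally show "(\<Sum>k\<le>K. norm (?f k x * t ^ k)) \<le> ?D \<bar>t\<bar> x" .
      qed
      finally show "(\<Sum>k\<le>K. \<integral>x. norm (?f k x * t ^ k) \<partial>M) \<le> (\<integral>x. ?D \<bar>t\<bar> x \<partial>M)" .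
    qed simp
  qed
  have "(\<Sum>k. ?f k x * t ^ k) = w x * exp (t * l x)" for x
  proof -
    have "(\<lambda>k. w x * ((t * l x) ^ k /\<^sub>R fact k)) sums (w x * exp (t * l x))"
      by (intro sums_mult exp_converges)
    then show ?thesis
      by (simp add: sums_iff power_mult_distrib divide_inverse mult_ac)
  qed
  then show ?thesis using sums by simp
qed

text \<open>One-sided identity theorem: a nonzero coefficient would keep the function away from zero
  on a punctured neighbourhood of 0, which contains small positive \<open>t\<close>.\<close>

lemma power_series_zero_right_imp_zero:
  fixes b :: "nat \<Rightarrow> real"
  assumes "0 < \<rho>" and s: "\<And>t. \<bar>t\<bar> < \<rho> \<Longrightarrow> (\<lambda>k. b k * t ^ k) sums f t"
    and z: "\<And>t. 0 < t \<Longrightarrow> t < \<rho> \<Longrightarrow> f t = 0" and t: "\<bar>t\<bar> < \<rho>"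
  shows "f t = 0"
proof -
  have "b m = 0" for m
  proof (rule ccontr)
    assume "b m \<noteq> 0"
    \<comment> \<open>The library lemma needs a series that vanishes at the centre, so multiply by \<open>t\<close>.\<close>
    define a where "a k = (case k of 0 \<Rightarrow> 0 | Suc j \<Rightarrow> b j)" for k
    have "(\<lambda>k. a k * (t - 0) ^ k) sums (t * f t)" if "norm (t - 0) < \<rho>" for t
    proof -
      have "(\<lambda>k. a (Suc k) * t ^ Suc k) sums (t * f t)"
        using sums_mult[OF s, of t t] that by (simp add: a_def mult_ac)
      then show ?thesis by (subst (asm) sums_Suc_iff) (simp add: a_def)
    qed
    moreover have "a (Suc m) \<noteq> 0" using \<open>b m \<noteq> 0\<close> by (simp add: a_def)
    ultimately obtain r where r: "0 < r" "\<And>x. x \<in> cball 0 r - {0} \<Longrightarrow> x * f x \<noteq> 0"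
      using powser_0_nonzero[where a = a and \<xi> = 0 and f = "\<lambda>t. t * f t" and m = "Suc m" and r = \<rho>]
        \<open>0 < \<rho>\<close> by auto
    have "min r (\<rho> / 2) * f (min r (\<rho> / 2)) \<noteq> 0"
      using r(1) \<open>0 < \<rho>\<close> by (intro r(2)) auto
    then show False using z[of "min r (\<rho> / 2)"] r(1) \<open>0 < \<rho>\<close> by auto
  qed
  then show ?thesis using s[OF t] by (simp add: sums_iff)
qed


subsection \<open>The segment on the surface of constant Hotelling statistic\<close>

definition tilt_mean :: "'p::finite \<Rightarrow> real \<Rightarrow> real^'p" where
  "tilt_mean r t = (\<chi> i. if i = r then t else 1)"

text \<open>
  A square root of \<open>a y y' + W\<close> for \<open>y = tilt_mean r t\<close> and the diagonal matrix \<open>W\<close> with entry \<open>0\<close> at \<open>q\<close>,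
  \<open>1 - a t\<^sup>2\<close> at \<open>r\<close> and \<open>1\<close> elsewhere. The entry at \<open>r\<close> cancels the only quadratic term in \<open>t\<close>.
\<close>

definition tilt_root :: "real \<Rightarrow> 'p \<Rightarrow> 'p \<Rightarrow> real \<Rightarrow> real^'p^'p" where
  "tilt_root a q r t = (\<chi> i j. if j = q then sqrt a * tilt_mean r t $ i
     else if i = j then (if j = r then sqrt (1 - a * t\<^sup>2) else 1) else 0)"

context
  fixes a t :: real and q r :: "'p::finite"
  assumes qr: "q \<noteq> r" and a: "0 < a" and t: "a * t\<^sup>2 < 1"
begin

lemma tilt_root_rows:
  "tilt_root a q r t $ i \<bullet> tilt_root a q r t $ j = a * tilt_mean r t $ i * tilt_mean r t $ j
    + (if i = j \<and> i \<noteq> q then if i = r then 1 - a * t\<^sup>2 else 1 else 0)"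
proof -
  let ?D = "if i = j \<and> i \<noteq> q then if i = r then 1 - a * t\<^sup>2 else 1 else 0"
  have "tilt_root a q r t $ i $ l * tilt_root a q r t $ j $ l =
      (if l = q then a * tilt_mean r t $ i * tilt_mean r t $ j else 0) + (if l = i then ?D else 0)" for l
    using a t qr by (auto simp: tilt_root_def)
  then show ?thesis by (simp add: inner_vec_def sum.distrib)
qed

text \<open>This is the raw second moment of the constructed sample. The entry at
  \<open>(r, r)\<close> is \<open>a * t\<^sup>2 + (1 - a * t\<^sup>2) = 1\<close>, and
  \<open>t\<close> survives, linearly, where exactly one index is \<open>r\<close>.\<close>

lemma tilt_root_rows_affine:
  "tilt_root a q r t $ i \<bullet> tilt_root a q r t $ j =
    (if i = r \<and> j = r then 1 else if i = r \<or> j = r then 0 else if i = j \<and> i \<noteq> q then a + 1 else a)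
    + t * (if (i = r) = (j = r) then 0 else a)"
  using qr by (auto simp: tilt_root_rows tilt_mean_def power2_eq_square)

lemma tilt_root_mult_vec:
  "(tilt_root a q r t *v x) $ i = sqrt a * tilt_mean r t $ i * x $ q
    + (if i = q then 0 else if i = r then sqrt (1 - a * t\<^sup>2) * x $ r else x $ i)"
proof -
  let ?D = "if i = q then 0 else if i = r then sqrt (1 - a * t\<^sup>2) * x $ r else x $ i"
  have "tilt_root a q r t $ i $ l * x $ l =
      (if l = q then sqrt a * tilt_mean r t $ i * x $ q else 0) + (if l = i then ?D else 0)" for l
    using qr by (auto simp: tilt_root_def)
  then show ?thesis by (simp add: matrix_vector_mult_def sum.distrib)
qed

lemma det_tilt_root: "det (tilt_root a q r t) \<noteq> 0"
proof (rule det_nonzeroI)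
  fix x assume 0: "tilt_root a q r t *v x = 0"
  have "sqrt a * x $ q = 0"
    using tilt_root_mult_vec[of x q] qr by (simp add: 0 tilt_mean_def)
  then have "x $ q = 0" using a by simp
  moreover have "x $ i = 0" if "i \<noteq> q" for i
    using tilt_root_mult_vec[of x i] that t \<open>x $ q = 0\<close> by (simp add: 0 split: if_splits)
  ultimately have "x $ i = 0" for i by metis
  then show "x = 0" by (simp add: vec_eq_iff)
qed

text \<open>Column \<open>q\<close> is \<open>sqrt a\<close> times the mean. One fixed \<eta>
  therefore produces the mean \<open>tilt_mean r t\<close> for every \<open>t\<close>.\<close>

lemma tilt_root_axis: "tilt_root a q r t *v (axis q (1 / sqrt a)) = tilt_mean r t"
  using a qr by (auto simp: vec_eq_iff tilt_root_mult_vec axis_def)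

end

subsection \<open>Bayes tests and the sign of the likelihood difference\<close>

text \<open>By continuity a positive value would persist on a nonempty open set, which is not
  negligible.\<close>

lemma AE_open_nonpos:
  fixes h :: "'a::euclidean_space \<Rightarrow> real"
  assumes "open W" "continuous_on W h" and ae: "AE x in lborel. x \<in> W \<longrightarrow> h x \<le> 0" and "x \<in> W"
  shows "h x \<le> 0"
proof (rule ccontr)
  let ?V = "W \<inter> h -` {0<..}"
  assume "\<not> h x \<le> 0"
  then have "?V \<noteq> {}" using \<open>x \<in> W\<close> by auto
  moreover have V: "open ?V" using assms by (intro continuous_open_preimage) auto
  moreover have "AE x in lborel. x \<notin> ?V" using ae by eventually_elim auto
  then have "?V \<in> null_sets lborel"
    using V by (subst (asm) AE_iff_null_sets[symmetric]) auto
  then have "negligible ?V"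
    by (simp add: negligible_iff_null_sets null_sets_completionI)
  ultimately show False using open_not_negligible by blast
qed

lemma bayes_ratio_eq: "bayes_ratio G G0 X = likelihood G X / likelihood G0 X"
  by (simp add: bayes_ratio_def likelihood_def case_prod_beta')

text \<open>Clearing the positive denominator turns the Bayes test into a sign condition, whatever
  the sign of \<open>c\<close>. On open sets continuity removes the exceptional null set.\<close>

lemma likelihood_ratio_sign:
  fixes R :: "(real^'p^'n) set" and c :: real
  assumes n: "1 < CARD('n)"
    and G: "prior_on (T \<times> pos_def_matrices) G" and G0: "prior_on (T0 \<times> pos_def_matrices) G0"
    and ae: "AE X in lborel. X \<in> R \<longleftrightarrow> c \<le> bayes_ratio G G0 X"
    and W: "open W" "W \<subseteq> {X. det (sample_cov X) \<noteq> 0}" "X \<in> W"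
  shows "W \<inter> R = {} \<Longrightarrow> likelihood G X - c * likelihood G0 X \<le> 0"
    and "W \<subseteq> R \<Longrightarrow> 0 \<le> likelihood G X - c * likelihood G0 X"
proof -
  let ?h = "\<lambda>X. likelihood G X - c * likelihood G0 X"
  have h: "continuous_on W ?h"
    using continuous_on_subset[OF continuous_on_likelihood[OF n G] W(2)]
      continuous_on_subset[OF continuous_on_likelihood[OF n G0] W(2)]
    by (intro continuous_intros)
  have iff: "c \<le> bayes_ratio G G0 X \<longleftrightarrow> 0 \<le> ?h X" if "X \<in> W" for X
    using likelihood_pos[OF n G0, of X] that W(2)
    by (auto simp: bayes_ratio_eq pos_le_divide_eq)
  show "W \<inter> R = {} \<Longrightarrow> ?h X \<le> 0"
  proof (rule AE_open_nonpos[OF W(1) h _ W(3)])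
    assume R: "W \<inter> R = {}"
    show "AE X in lborel. X \<in> W \<longrightarrow> ?h X \<le> 0"
      using ae
    proof eventually_elim
      case (elim X)
      show ?case using elim R iff[of X] by (cases "X \<in> W") (auto simp: not_le)
    qed
  qed
  have "W \<subseteq> R \<Longrightarrow> - ?h X \<le> 0"
  proof (rule AE_open_nonpos[OF W(1) continuous_on_minus[OF h] _ W(3)])
    assume R: "W \<subseteq> R"
    show "AE X in lborel. X \<in> W \<longrightarrow> - ?h X \<le> 0"
      using ae
    proof eventually_elim
      case (elim X)
      show ?case using elim R iff[of X] by (cases "X \<in> W") auto
    qed
  qed
  then show "W \<subseteq> R \<Longrightarrow> 0 \<le> ?h X" by simp
qed

section \<open>Open regions of samples on which the statistic is explicit\<close>

lemma continuous_on_hotelling: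
  "continuous_on {X :: real^'p^'n. det (sample_cov X) \<noteq> 0} hotelling"
  unfolding hotelling_def
  by (intro continuous_intros continuous_on_sample_mean continuous_on_matrix_vector_mult
      continuous_on_matrix_inv continuous_on_sample_cov) auto

lemma open_interior_region:
  fixes B :: "real set"
  assumes "open B"
  shows "open {X :: real^'p^'n. det (sample_cov X) \<noteq> 0 \<and> (\<forall>i. 0 < sample_mean X $ i) \<and> hotelling X \<in> B}"
proof -
  let ?\<Omega> = "{X :: real^'p^'n. det (sample_cov X) \<noteq> 0}"
  have "open {X :: real^'p^'n. 0 < sample_mean X $ i}" for i
    by (intro open_Collect_less continuous_on_const continuous_on_component continuous_on_sample_mean)
  then have "open ((?\<Omega> \<inter> hotelling -` B) \<inter> (\<Inter>i. {X. 0 < sample_mean X $ i}))"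
    by (intro open_Int[OF continuous_open_preimage[OF continuous_on_hotelling open_nonsingular assms]] open_INT ballI) auto
  also have "\<dots> = {X. det (sample_cov X) \<noteq> 0 \<and> (\<forall>i. 0 < sample_mean X $ i) \<and> hotelling X \<in> B}" by auto
  finally show ?thesis .
qed

lemma open_facet_region:
  assumes n: "1 < CARD('n)"
  shows "open {X :: real^'p^'n. det (sample_cov X) \<noteq> 0 \<and> sample_mean X $ r < 0 \<and>
    (\<forall>i. i \<noteq> r \<longrightarrow> 0 < sample_mean X $ i - sample_cov X $ i $ r * (sample_mean X $ r / sample_cov X $ r $ r)) \<and>
    hotelling X - real CARD('n) * (sample_mean X $ r)\<^sup>2 / sample_cov X $ r $ r < u}" (is "open ?W")
proof -
  let ?\<Omega> = "{X :: real^'p^'n. det (sample_cov X) \<noteq> 0}"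
  let ?f = "\<lambda>X :: real^'p^'n. sample_mean X $ r"
  let ?g = "\<lambda>i X :: real^'p^'n. sample_mean X $ i - sample_cov X $ i $ r * (sample_mean X $ r / sample_cov X $ r $ r)"
  let ?k = "\<lambda>X :: real^'p^'n. hotelling X - real CARD('n) * (sample_mean X $ r)\<^sup>2 / sample_cov X $ r $ r"
  have S: "sample_cov X $ r $ r \<noteq> 0" if "X \<in> ?\<Omega>" for X
    using cond_single(4)[OF n, of X r] that by simp
  note ci = continuous_on_component continuous_on_sample_mean continuous_on_sample_cov continuous_on_hotelling
  have "continuous_on ?\<Omega> ?f" "continuous_on ?\<Omega> (?g i)" "continuous_on ?\<Omega> ?k" for i
    using S by (intro continuous_intros ci; simp)+
  then have "open ((?\<Omega> \<inter> ?f -` {..<0}) \<inter> (\<Inter>i\<in>- {r}. ?\<Omega> \<inter> ?g i -` {0<..}) \<inter> (?\<Omega> \<inter> ?k -` {..<u}))"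
    by (intro open_Int open_INT continuous_open_preimage open_nonsingular ballI) auto
  also have "\<dots> = ?W" by (auto simp: Ball_def)
  finally show ?thesis .
qed

lemma likelihood_point_mean:
  fixes X Y :: "real^'p^'n"
  assumes "\<And>i j. (\<Sum>k\<in>UNIV. X $ k $ i * X $ k $ j) = (\<Sum>k\<in>UNIV. Y $ k $ i * Y $ k $ j)"
    and G0: "prior_on ({0} \<times> pos_def_matrices) G0"
  shows "likelihood G0 X = likelihood G0 Y"
  unfolding likelihood_def
proof (intro Bochner_Integration.integral_cong refl)
  fix \<omega> assume "\<omega> \<in> space G0"
  then have \<omega>: "fst \<omega> = 0" "snd \<omega> \<in> pos_def_matrices"
    using G0 by (auto simp: prior_on_def)
  have s: "transpose (matrix_inv (snd \<omega>)) = matrix_inv (snd \<omega>)"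
    using pos_def_matrix_inv[OF \<omega>(2)] by (simp add: pos_def_matrices_def)
  show "joint_density (fst \<omega>) (snd \<omega>) X = joint_density (fst \<omega>) (snd \<omega>) Y"
    unfolding joint_density_eq residual_quad_expand[OF s] by (simp add: \<omega>(1) assms(1))
qed

text \<open>An affine change of mean and second moment multiplies the density by an exponential that
  is linear in \<open>t\<close>. It is used once with moving moments (analyticity) and once with
  \<open>D = 0\<close> (convexity in the mean).\<close>

lemma joint_density_tilt:
  fixes X Y :: "real^'p^'n"
  assumes "\<Sigma> \<in> pos_def_matrices"
    and V: "\<And>i j. (\<Sum>k\<in>UNIV. Y $ k $ i * Y $ k $ j) = (\<Sum>k\<in>UNIV. X $ k $ i * X $ k $ j) + t * D i j"
    and m: "sample_mean Y = sample_mean X + t *\<^sub>R v"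
  shows "joint_density \<theta> \<Sigma> Y = joint_density \<theta> \<Sigma> X *
    exp (t * (real CARD('n) * (\<theta> \<bullet> (matrix_inv \<Sigma> *v v)) - (\<Sum>i\<in>UNIV. \<Sum>j\<in>UNIV. matrix_inv \<Sigma> $ i $ j * D i j) / 2))"
proof -
  have s: "transpose (matrix_inv \<Sigma>) = matrix_inv \<Sigma>"
    using pos_def_matrix_inv[OF assms(1)] by (simp add: pos_def_matrices_def)
  have "residual_quad \<theta> (matrix_inv \<Sigma>) Y = residual_quad \<theta> (matrix_inv \<Sigma>) X
    + t * (\<Sum>i\<in>UNIV. \<Sum>j\<in>UNIV. matrix_inv \<Sigma> $ i $ j * D i j) - 2 * t * (real CARD('n) * (\<theta> \<bullet> (matrix_inv \<Sigma> *v v)))"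
    unfolding residual_quad_expand[OF s] V m
    by (simp add: distrib_left sum.distrib sum_distrib_left matrix_vector_right_distrib
        matrix_vector_mult_scaleR inner_add_right mult_ac)
  then have "- residual_quad \<theta> (matrix_inv \<Sigma>) Y / 2 = - residual_quad \<theta> (matrix_inv \<Sigma>) X / 2
    + t * (real CARD('n) * (\<theta> \<bullet> (matrix_inv \<Sigma> *v v)) - (\<Sum>i\<in>UNIV. \<Sum>j\<in>UNIV. matrix_inv \<Sigma> $ i $ j * D i j) / 2)"
    by (simp add: field_simps)
  then show ?thesis unfolding joint_density_eq by (simp only: exp_add) simp
qed

text \<open>By exponential tilting the likelihood along the path is a Laplace transform of the
  measure with density \<open>joint_density\<close> at \<open>t = 0\<close>.\<close>

lemma likelihood_power_series:
  fixes X :: "real \<Rightarrow> real^'p^'n"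
  assumes n: "1 < CARD('n)" and G: "prior_on (T \<times> pos_def_matrices) G"
    and X: "\<And>t. \<bar>t\<bar> < \<rho> \<Longrightarrow> det (sample_cov (X t)) \<noteq> 0"
    and V: "\<And>t i j. \<bar>t\<bar> < \<rho> \<Longrightarrow>
      (\<Sum>k\<in>UNIV. X t $ k $ i * X t $ k $ j) = (\<Sum>k\<in>UNIV. X 0 $ k $ i * X 0 $ k $ j) + t * D i j"
    and m: "\<And>t. \<bar>t\<bar> < \<rho> \<Longrightarrow> sample_mean (X t) = sample_mean (X 0) + t *\<^sub>R v"
  obtains b where "\<And>t. \<bar>t\<bar> < \<rho> \<Longrightarrow> (\<lambda>k. b k * t ^ k) sums likelihood G (X t)"
proof -
  define l where "l \<omega> = real CARD('n) * (fst \<omega> \<bullet> (matrix_inv (snd \<omega>) *v v))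
    - (\<Sum>i\<in>UNIV. \<Sum>j\<in>UNIV. matrix_inv (snd \<omega>) $ i $ j * D i j) / 2" for \<omega> :: "(real^'p) \<times> (real^'p^'p)"
  have l: "l \<in> borel_measurable G"
    unfolding l_def
    by (intro prior_on_measurable[OF G] continuous_intros continuous_on_matrix_vector_mult
        continuous_on_component continuous_on_matrix_inv) (auto dest: pos_def_det_nonzero)
  have w: "(\<lambda>\<omega>. joint_density (fst \<omega>) (snd \<omega>) (X 0)) \<in> borel_measurable G"
    by (rule prior_on_measurable[OF G continuous_on_joint_density])
  have eq: "joint_density (fst \<omega>) (snd \<omega>) (X t) = joint_density (fst \<omega>) (snd \<omega>) (X 0) * exp (t * l \<omega>)"
    if "\<omega> \<in> space G" "\<bar>t\<bar> < \<rho>" for \<omega> t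
    unfolding l_def using prior_on_space(1)[OF G that(1)] V[OF that(2)] m[OF that(2)]
    by (rule joint_density_tilt)
  have int: "integrable G (\<lambda>\<omega>. joint_density (fst \<omega>) (snd \<omega>) (X 0) * exp (t * l \<omega>))" if "\<bar>t\<bar> < \<rho>" for t
    using integrable_joint_density[OF n G X[OF that]] eq[OF _ that]
    by (simp cong: Bochner_Integration.integrable_cong)
  have lik: "likelihood G (X t) = (\<integral>\<omega>. joint_density (fst \<omega>) (snd \<omega>) (X 0) * exp (t * l \<omega>) \<partial>G)" if "\<bar>t\<bar> < \<rho>" for t
    unfolding likelihood_def by (intro Bochner_Integration.integral_cong refl eq that)
  show ?thesis
  proof
    fix t assume t: "\<bar>t\<bar> < \<rho>"
    show "(\<lambda>k. (\<integral>\<omega>. joint_density (fst \<omega>) (snd \<omega>) (X 0) * l \<omega> ^ k / fact k \<partial>G) * t ^ k) sums likelihood G (X t)"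
      unfolding lik[OF t]
      using joint_density_prior_pos[OF G] by (intro laplace_transform_power_series[OF w l _ int t]) (auto intro: less_imp_le)
  qed
qed


text \<open>The common core for both cones. From the statistic it takes its form where all means are
  positive and its form where coordinate \<open>r\<close> alone is regressed out.\<close>

lemma not_bayes_test:
  fixes U :: "real^'p^'n \<Rightarrow> real" and q r :: 'p
  assumes pn: "CARD('p) < CARD('n)" and qr: "q \<noteq> r" and u: "0 < u"
    and interior: "\<And>X. det (sample_cov X) \<noteq> 0 \<Longrightarrow> (\<And>i. 0 < sample_mean X $ i) \<Longrightarrow> U X = hotelling X"
    and facet: "\<And>X. det (sample_cov X) \<noteq> 0 \<Longrightarrow> sample_mean X $ r < 0 \<Longrightarrow>
      (\<And>i. i \<noteq> r \<Longrightarrow> 0 < sample_mean X $ i - sample_cov X $ i $ r * (sample_mean X $ r / sample_cov X $ r $ r)) \<Longrightarrow>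
      U X = hotelling X - real CARD('n) * (sample_mean X $ r)\<^sup>2 / sample_cov X $ r $ r"
  shows "\<not> bayes_test C {X. U X > u}"
proof
  assume "bayes_test C {X. U X > u}"
  then obtain G G0 and c :: real where
    G: "prior_on ((C - {0}) \<times> pos_def_matrices) G" and G0: "prior_on ({0} \<times> pos_def_matrices) G0"
    and ae: "AE X in lborel. X \<in> {X. U X > u} \<longleftrightarrow> c \<le> bayes_ratio G G0 X"
    unfolding bayes_test_def by blast
  let ?\<Omega> = "{X :: real^'p^'n. det (sample_cov X) \<noteq> 0}"
  define h where "h X = likelihood G X - c * likelihood G0 X" for X :: "real^'p^'n"
  define N where "N = real CARD('n)"
  have "0 < CARD('p)" by simp
  then have n: "1 < CARD('n)" using pn by linarith
  then have N: "1 < N" by (simp add: N_def)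
  obtain z :: "'n \<Rightarrow> real^'p" where z: "(\<Sum>k\<in>UNIV. z k) = 0" "\<And>u v. (\<Sum>k\<in>UNIV. (u \<bullet> z k) * (v \<bullet> z k)) = u \<bullet> v"
    using orthonormal_contrasts[OF pn] by blast
  \<comment> \<open>Chosen so that \<open>\<eta> \<bullet> \<eta> = 1 / a\<close> gives Hotelling's
    statistic the value \<open>N * (N - 1) / (a - N) = u\<close>.\<close>
  define \<kappa> where "\<kappa> = N * (N - 1) / u"
  define a where "a = N + \<kappa>"
  have \<kappa>: "0 < \<kappa>" "u * \<kappa> = N * (N - 1)" using u N by (simp_all add: \<kappa>_def)
  then have a: "0 < a" "N < a" using N by (simp_all add: a_def)
  \<comment> \<open>Within this radius \<open>1 - a * t\<^sup>2\<close> is positive, so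
    \<open>tilt_root\<close> is real and nonsingular.\<close>
  define \<rho> where "\<rho> = 1 / sqrt a"
  have \<rho>: "0 < \<rho>" using a by (simp add: \<rho>_def)
  have at: "a * t\<^sup>2 < 1" if "\<bar>t\<bar> < \<rho>" for t
  proof -
    have "t\<^sup>2 < \<rho>\<^sup>2" using that by (metis abs_ge_zero power2_abs power_strict_mono pos2)
    then show ?thesis using a by (simp add: \<rho>_def power_divide field_simps)
  qed
  define e :: "real^'p" where "e = axis q (1 / sqrt a)"
  have ee: "e \<bullet> e = 1 / a" using a by (simp add: e_def inner_axis_axis)
  define X where "X t \<eta> = mk_sample z (tilt_root a q r t) \<eta>" for t \<eta>
  have mean: "sample_mean (X t \<eta>) = tilt_root a q r t *v \<eta>" if "N * (\<eta> \<bullet> \<eta>) < 1" for t \<eta>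
    unfolding X_def using sample_mean_mk_sample[OF n z] that by (simp add: N_def)
  have moment: "(\<Sum>k\<in>UNIV. X t \<eta> $ k $ i * X t \<eta> $ k $ j) = tilt_root a q r t $ i \<bullet> tilt_root a q r t $ j"
    if "N * (\<eta> \<bullet> \<eta>) < 1" for t \<eta> i j
    unfolding X_def using raw_moment_mk_sample[OF n z] that by (simp add: N_def)
  have det: "det (sample_cov (X t \<eta>)) \<noteq> 0" if "N * (\<eta> \<bullet> \<eta>) < 1" "\<bar>t\<bar> < \<rho>" for t \<eta>
    unfolding X_def using det_sample_cov_mk_sample[OF n z _ det_tilt_root[OF qr a(1) at]] that by (simp add: N_def)
  have hot: "hotelling (X t \<eta>) = N * (N - 1) * (\<eta> \<bullet> \<eta>) / (1 - N * (\<eta> \<bullet> \<eta>))"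
    if "N * (\<eta> \<bullet> \<eta>) < 1" "\<bar>t\<bar> < \<rho>" for t \<eta>
    unfolding X_def using hotelling_mk_sample[OF n z _ det_tilt_root[OF qr a(1) at]] that by (simp add: N_def)
  have e1: "N * (e \<bullet> e) < 1" using a by (simp add: ee)
  have mean_e: "tilt_root a q r t *v e = tilt_mean r t" if "\<bar>t\<bar> < \<rho>" for t
    unfolding e_def by (rule tilt_root_axis[OF qr a(1) at[OF that]])
  have h_cont: "continuous_on T (\<lambda>x. h (X t (f x)))"
    if f: "continuous_on T f" "\<And>x. x \<in> T \<Longrightarrow> N * (f x \<bullet> f x) < 1" and t: "\<bar>t\<bar> < \<rho>" for T f t
  proof -
    have cX: "continuous_on T (\<lambda>x. X t (f x))"
      unfolding X_def by (rule continuous_on_mk_sample) (use f in \<open>auto simp: N_def\<close>)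
    have "continuous_on ?\<Omega> h"
      unfolding h_def by (intro continuous_intros continuous_on_likelihood[OF n G] continuous_on_likelihood[OF n G0])
    then show ?thesis using f(2) det[OF _ t]
      by (intro continuous_on_compose2[OF _ cX]) auto
  qed
  note sign = likelihood_ratio_sign[OF n G G0 ae, folded h_def]

  have right: "h (X t e) = 0" if t: "0 < t" "t < \<rho>" for t
  proof -
    \<comment> \<open>The ray through \<open>e\<close> crosses the surface at \<open>s = 1\<close>,
      and all means on it are positive. The bound \<sigma> is where
      \<open>N * \<bar>s e\<bar>\<^sup>2\<close> would reach 1; it exceeds 1, so both sides of the
      surface are available.\<close>
    define \<sigma> where "\<sigma> = sqrt (a / N)"
    have \<sigma>: "1 < \<sigma>" using a N by (simp add: \<sigma>_def)
    have Ns: "N * ((s *\<^sub>R e) \<bullet> (s *\<^sub>R e)) < 1" if "s \<in> {0<..<\<sigma>}" for s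
    proof -
      have "s\<^sup>2 < \<sigma>\<^sup>2" using that by (intro power_strict_mono) auto
      then show ?thesis using a N by (simp add: ee \<sigma>_def field_simps power2_eq_square)
    qed
    have t': "\<bar>t\<bar> < \<rho>" using t by simp
    have pos: "0 < sample_mean (X t (s *\<^sub>R e)) $ i" if "s \<in> {0<..<\<sigma>}" for s i
      using that t by (simp add: mean[OF Ns[OF that]] matrix_vector_mult_scaleR mean_e[OF t'] tilt_mean_def)
    have hs: "hotelling (X t (s *\<^sub>R e)) - u = (N * (N - 1) + u * N) * (s\<^sup>2 - 1) / (a - N * s\<^sup>2)" (is ?eq)
      and d: "0 < a - N * s\<^sup>2" if "s \<in> {0<..<\<sigma>}" for s
    proof -
      show d: "0 < a - N * s\<^sup>2" using Ns[OF that] a by (simp add: ee power2_eq_square field_simps)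
      have "hotelling (X t (s *\<^sub>R e)) = N * (N - 1) * (s\<^sup>2 / a) / (1 - N * (s\<^sup>2 / a))"
        using hot[OF Ns[OF that] t'] by (simp add: ee power2_eq_square)
      also have "\<dots> = N * (N - 1) * s\<^sup>2 / (a - N * s\<^sup>2)" using a d by (simp add: field_simps)
      finally have "hotelling (X t (s *\<^sub>R e)) - u = (N * (N - 1) * s\<^sup>2 - u * (a - N * s\<^sup>2)) / (a - N * s\<^sup>2)"
        using d by (simp add: diff_divide_distrib)
      also have "N * (N - 1) * s\<^sup>2 - u * (a - N * s\<^sup>2) = (N * (N - 1) + u * N) * (s\<^sup>2 - 1)"
        using \<kappa>(2) by (simp add: a_def algebra_simps)
      finally show ?eq .
    qed
    have K: "0 < N * (N - 1) + u * N" using N u by (simp add: add_pos_pos)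
    define f where "f s = h (X t (s *\<^sub>R e))" for s
    let ?W = "\<lambda>B. {Y :: real^'p^'n. det (sample_cov Y) \<noteq> 0 \<and> (\<forall>i. 0 < sample_mean Y $ i) \<and> hotelling Y \<in> B}"
    have low: "f s \<le> 0" if s: "0 < s" "s < 1" for s
      unfolding f_def
    proof (rule sign(1)[of "?W {..<u}"])
      have s': "s \<in> {0<..<\<sigma>}" using s \<sigma> by auto
      have "s\<^sup>2 < 1" using s by (simp add: power_less_one_iff)
      then have "hotelling (X t (s *\<^sub>R e)) - u < 0"
        unfolding hs[OF s'] using d[OF s'] K by (intro divide_neg_pos mult_pos_neg) auto
      then show "X t (s *\<^sub>R e) \<in> ?W {..<u}" using det[OF Ns[OF s'] t'] pos[OF s'] by simp
      show "open (?W {..<u})" by (rule open_interior_region) simp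
    qed (auto simp: interior)
    have up: "0 \<le> f s" if s: "1 < s" "s < \<sigma>" for s
      unfolding f_def
    proof (rule sign(2)[of "?W {u<..}"])
      have s': "s \<in> {0<..<\<sigma>}" using s by auto
      have "1 < s\<^sup>2" using s by (simp add: one_less_power)
      then have "0 < hotelling (X t (s *\<^sub>R e)) - u"
        unfolding hs[OF s'] using d[OF s'] K by simp
      then show "X t (s *\<^sub>R e) \<in> ?W {u<..}" using det[OF Ns[OF s'] t'] pos[OF s'] by simp
      show "open (?W {u<..})" by (rule open_interior_region) simp
    qed (auto simp: interior)
    have "continuous_on {0<..<\<sigma>} f"
      unfolding f_def by (intro h_cont continuous_intros Ns t') auto
    then have "isCont f 1" using \<sigma> by (simp add: continuous_on_eq_continuous_at)
    then have lim: "(f \<longlongrightarrow> f 1) (at_left 1)" "(f \<longlongrightarrow> f 1) (at_right 1)"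
      by (auto simp: isCont_def filterlim_at_split)
    have "\<forall>\<^sub>F s in at_left 1. f s \<le> 0"
      using eventually_at_left_real[of 0 "1::real"] by (auto elim!: eventually_mono intro: low)
    then have "f 1 \<le> 0" using tendsto_upperbound[OF lim(1)] by simp
    moreover have "\<forall>\<^sub>F s in at_right 1. 0 \<le> f s"
      using eventually_at_right_real[OF \<sigma>] by (auto elim!: eventually_mono intro: up)
    then have "0 \<le> f 1" using tendsto_lowerbound[OF lim(2)] by simp
    ultimately show ?thesis by (simp add: f_def)
  qed

  have everywhere: "h (X t e) = 0" if "\<bar>t\<bar> < \<rho>" for t
  proof -
    \<comment> \<open>Second moment and mean are both affine in \<open>t\<close>, so the likelihoods
      under \<open>G\<close> and \<open>G0\<close> have power series on the same interval.\<close>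
    have V: "(\<Sum>k\<in>UNIV. X t e $ k $ i * X t e $ k $ j) =
        (\<Sum>k\<in>UNIV. X 0 e $ k $ i * X 0 e $ k $ j) + t * (if (i = r) = (j = r) then 0 else a)"
      if "\<bar>t\<bar> < \<rho>" for t i j
      using tilt_root_rows_affine[OF qr a(1) at[OF that], of i j] tilt_root_rows_affine[OF qr a(1) at[of 0], of i j] \<rho>
      by (simp add: moment[OF e1])
    have m: "sample_mean (X t e) = sample_mean (X 0 e) + t *\<^sub>R axis r 1" if "\<bar>t\<bar> < \<rho>" for t
      using that \<rho> by (simp add: mean[OF e1] mean_e tilt_mean_def vec_eq_iff axis_def)
    obtain b where b: "\<And>t. \<bar>t\<bar> < \<rho> \<Longrightarrow> (\<lambda>k. b k * t ^ k) sums likelihood G (X t e)"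
      using likelihood_power_series[OF n G det[OF e1] V m] by metis
    obtain b0 where b0: "\<And>t. \<bar>t\<bar> < \<rho> \<Longrightarrow> (\<lambda>k. b0 k * t ^ k) sums likelihood G0 (X t e)"
      using likelihood_power_series[OF n G0 det[OF e1] V m] by metis
    have "(\<lambda>k. (b k - c * b0 k) * t ^ k) sums h (X t e)" if "\<bar>t\<bar> < \<rho>" for t
      using sums_diff[OF b[OF that] sums_mult[OF b0[OF that], of c]] by (simp add: h_def algebra_simps)
    then show ?thesis
      by (rule power_series_zero_right_imp_zero[where f = "\<lambda>t. h (X t e)", OF \<rho> _ right that])
  qed

  \<comment> \<open>Any negative value in the interval would serve.\<close>
  define t where "t = - (\<rho> / 2)"
  have t: "\<bar>t\<bar> < \<rho>" "t < 0" using \<rho> by (auto simp: t_def)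
  let ?L = "tilt_root a q r t"
  let ?W = "{Y :: real^'p^'n. det (sample_cov Y) \<noteq> 0 \<and> sample_mean Y $ r < 0 \<and>
    (\<forall>i. i \<noteq> r \<longrightarrow> 0 < sample_mean Y $ i - sample_cov Y $ i $ r * (sample_mean Y $ r / sample_cov Y $ r $ r)) \<and>
    hotelling Y - real CARD('n) * (sample_mean Y $ r)\<^sup>2 / sample_cov Y $ r $ r < u}"
  have W: "h Y \<le> 0" if "Y \<in> ?W" for Y
    by (rule sign(1)[OF open_facet_region[OF n] _ that]) (auto simp: facet)
  have XW: "X t e \<in> ?W"
  proof -
    have m: "sample_mean (X t e) = tilt_mean r t" using mean[OF e1] mean_e t by simp
    have S: "sample_cov (X t e) $ i $ r = (\<kappa> * tilt_mean r t $ i * t + (if i = r then 1 - a * t\<^sup>2 else 0)) / (N - 1)" for i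
    proof -
      have "sample_cov (X t e) $ i $ r = (?L $ i \<bullet> ?L $ r - N * tilt_mean r t $ i * t) / (N - 1)"
        by (simp add: sample_cov_component moment[OF e1] m N_def tilt_mean_def)
      also have "?L $ i \<bullet> ?L $ r - N * tilt_mean r t $ i * t = \<kappa> * tilt_mean r t $ i * t + (if i = r then 1 - a * t\<^sup>2 else 0)"
        unfolding tilt_root_rows[OF qr a(1) at[OF t(1)]]
        using qr by (simp add: a_def tilt_mean_def power2_eq_square algebra_simps)
      finally show ?thesis .
    qed
    \<comment> \<open>This is \<open>N - 1\<close> times the variance at \<open>r\<close>. With it
      the conditional means of the other coordinates become \<open>(1 - a * t\<^sup>2) / D\<close>,
      which is positive.\<close>
    define D where "D = \<kappa> * t\<^sup>2 + (1 - a * t\<^sup>2)"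
    have D: "0 < D" unfolding D_def using \<kappa>(1) at[OF t(1)] by (intro add_nonneg_pos) auto
    have Srr: "sample_cov (X t e) $ r $ r = D / (N - 1)" by (simp add: S tilt_mean_def D_def power2_eq_square)
    have Sir: "sample_cov (X t e) $ i $ r = \<kappa> * t / (N - 1)" if "i \<noteq> r" for i
      using that by (simp add: S tilt_mean_def)
    have "0 < 1 - \<kappa> * t / (N - 1) * (t / (D / (N - 1)))"
    proof -
      have "1 - \<kappa> * t / (N - 1) * (t / (D / (N - 1))) = (1 - a * t\<^sup>2) / D"
        using D N by (simp add: field_simps power2_eq_square) (simp add: D_def power2_eq_square algebra_simps)
      then show ?thesis using D at[OF t(1)] by simp
    qed
    moreover have "hotelling (X t e) = u"
    proof -
      have "1 - N * (1 / a) = \<kappa> / a" using a(1) by (simp add: field_simps a_def)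
      then have "hotelling (X t e) = N * (N - 1) / \<kappa>" using hot[OF e1 t(1)] a(1) by (simp add: ee)
      then show ?thesis using \<kappa>(1) by (simp add: \<kappa>(2)[symmetric])
    qed
    moreover have "0 < N * t\<^sup>2 / (D / (N - 1))" using N D t by simp
    ultimately show ?thesis
      using det[OF e1 t(1)] t(2) by (simp add: m Srr Sir tilt_mean_def N_def[symmetric])
  qed

  have score0: "AE \<omega> in G. fst \<omega> \<bullet> (matrix_inv (snd \<omega>) *v (?L *v axis i 1)) = 0" for i
  proof -
    define d where "d = ?L *v axis i 1"
    define Q where "Q = {\<eta> :: real^'p. N * (\<eta> \<bullet> \<eta>) < 1}"
    have Q: "open Q" unfolding Q_def by (intro open_Collect_less continuous_intros)
    have "continuous_on Q (X t)"
      unfolding X_def by (rule continuous_on_mk_sample) (auto simp: Q_def N_def intro: continuous_on_id)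
    then have "open (Q \<inter> X t -` ?W)" using Q open_facet_region[OF n] by (rule continuous_open_preimage)
    moreover have "e \<in> Q \<inter> X t -` ?W" using XW e1 by (simp add: Q_def)
    \<comment> \<open>Small steps in \<eta> stay in the region where \<open>h \<le> 0\<close>. They
      move the mean along a column of \<open>?L\<close> and leave the second moment fixed.\<close>
    ultimately obtain s where s: "0 < s" "cball e s \<subseteq> Q \<inter> X t -` ?W"
      using open_contains_cball by blast
    let ?p = "e + s *\<^sub>R axis i 1" and ?m = "e + (- s) *\<^sub>R axis i 1"
    have "?p \<in> cball e s" "?m \<in> cball e s" using s(1) by (auto simp: dist_norm norm_axis_1)
    then have pm_in: "?p \<in> Q" "?m \<in> Q" "X t ?p \<in> ?W" "X t ?m \<in> ?W" using s(2) by blast+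
    note pm = pm_in(1,2)[unfolded Q_def mem_Collect_eq] pm_in(3,4)[THEN W]
    have G0_eq: "likelihood G0 (X t \<eta>) = likelihood G0 (X t e)" if "N * (\<eta> \<bullet> \<eta>) < 1" for \<eta>
      by (rule likelihood_point_mean[OF _ G0]) (simp add: moment[OF e1] moment[OF that])
    \<comment> \<open>\<open>h\<close> is zero at the centre and nonpositive at both ends, and the
      \<open>G0\<close> terms agree at all three points, so they cancel in the second
      difference.\<close>
    have le: "likelihood G (X t ?p) + likelihood G (X t ?m) - 2 * likelihood G (X t e) \<le> 0"
      using pm(3,4) everywhere[OF t(1)] G0_eq[OF pm(1)] G0_eq[OF pm(2)] by (simp add: h_def)
    define l where "l \<omega> = N * (fst \<omega> \<bullet> (matrix_inv (snd \<omega>) *v d))" for \<omega> :: "(real^'p) \<times> (real^'p^'p)"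
    define w where "w \<omega> = joint_density (fst \<omega>) (snd \<omega>) (X t e)" for \<omega>
    have tilt: "joint_density (fst \<omega>) (snd \<omega>) (X t (e + x *\<^sub>R axis i 1)) = w \<omega> * exp (x * l \<omega>)"
      if "\<omega> \<in> space G" "N * ((e + x *\<^sub>R axis i 1) \<bullet> (e + x *\<^sub>R axis i 1)) < 1" for \<omega> x
    proof -
      have "sample_mean (X t (e + x *\<^sub>R axis i 1)) = sample_mean (X t e) + x *\<^sub>R d"
        unfolding mean[OF that(2)] mean[OF e1] d_def by (simp only: matrix_vector_right_distrib matrix_vector_mult_scaleR)
      then show ?thesis
        using joint_density_tilt[OF prior_on_space(1)[OF G that(1)], of "X t (e + x *\<^sub>R axis i 1)" "X t e" x "\<lambda>i j. 0" d "fst \<omega>"]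
        by (simp add: moment[OF that(2)] moment[OF e1] l_def w_def N_def)
    qed
    note int = integrable_joint_density[OF n G det[OF _ t(1)]]
    define g where "g \<omega> = joint_density (fst \<omega>) (snd \<omega>) (X t ?p) + joint_density (fst \<omega>) (snd \<omega>) (X t ?m)
        - 2 * joint_density (fst \<omega>) (snd \<omega>) (X t e)" for \<omega>
    have g_int: "integrable G g" unfolding g_def
      by (intro Bochner_Integration.integrable_add Bochner_Integration.integrable_diff integrable_mult_right int pm e1)
    \<comment> \<open>The second difference of an exponential is a positive weight times a square.
      Its integral is nonpositive, so the square vanishes almost surely, which forces
      \<open>l \<omega> = 0\<close>.\<close>
    have g: "g \<omega> = w \<omega> * (exp (s * l \<omega> / 2) - exp (- (s * l \<omega> / 2)))\<^sup>2" if "\<omega> \<in> space G" for \<omega>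
    proof -
      have "g \<omega> = w \<omega> * (exp (s * l \<omega>) + exp (- s * l \<omega>) - 2)"
        unfolding g_def tilt[OF that pm(1)] tilt[OF that pm(2)] w_def[symmetric] by (simp only: algebra_simps)
      also have "exp (s * l \<omega>) + exp (- s * l \<omega>) - 2 = (exp (s * l \<omega> / 2) - exp (- (s * l \<omega> / 2)))\<^sup>2"
        by (simp add: power2_diff exp_double[symmetric] mult.assoc mult_exp_exp)
      finally show ?thesis .
    qed
    have w: "0 < w \<omega>" if "\<omega> \<in> space G" for \<omega>
      unfolding w_def by (rule joint_density_prior_pos[OF G that])
    have g_nonneg: "AE \<omega> in G. 0 \<le> g \<omega>" using g w by (intro AE_I2) (simp add: less_imp_le)
    have "integral\<^sup>L G g \<le> 0"
      unfolding g_def using le int[OF pm(1)] int[OF pm(2)] int[OF e1] by (simp add: likelihood_def)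
    then have "integral\<^sup>L G g = 0" using integral_nonneg_AE[OF g_nonneg] by linarith
    then have "AE \<omega> in G. g \<omega> = 0" using integral_nonneg_eq_0_iff_AE[OF g_int g_nonneg] by simp
    then show ?thesis
    proof (rule AE_mp, intro AE_I2 impI)
      fix \<omega> assume \<omega>: "\<omega> \<in> space G" "g \<omega> = 0"
      have "w \<omega> * (exp (s * l \<omega> / 2) - exp (- (s * l \<omega> / 2)))\<^sup>2 = 0" using g[OF \<omega>(1)] \<omega>(2) by simp
      then have "exp (s * l \<omega> / 2) = exp (- (s * l \<omega> / 2))" using w[OF \<omega>(1)] by simp
      then have "l \<omega> = 0" using s(1) by simp
      then show "fst \<omega> \<bullet> (matrix_inv (snd \<omega>) *v (?L *v axis i 1)) = 0" using N by (simp add: l_def d_def)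
    qed
  qed
  have all0: "AE \<omega> in G. \<forall>i. fst \<omega> \<bullet> (matrix_inv (snd \<omega>) *v (?L *v axis i 1)) = 0"
    using score0 by (simp add: AE_all_countable)
  \<comment> \<open>Here the transformed \<theta> is orthogonal to every column of the nonsingular
    \<open>?L\<close>; inverting \<open>?L\<close> and the precision gives \<theta> = 0, which the
    space of \<open>G\<close> excludes.\<close>
  have no: False if \<omega>: "\<omega> \<in> space G" and 0: "\<forall>i. fst \<omega> \<bullet> (matrix_inv (snd \<omega>) *v (?L *v axis i 1)) = 0" for \<omega>
  proof -
    let ?\<Lambda> = "matrix_inv (snd \<omega>)"
    note \<Sigma> = prior_on_space(1)[OF G \<omega>]
    have "(transpose ?L *v (transpose ?\<Lambda> *v fst \<omega>)) $ i = 0" for i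
      using 0[rule_format, of i] by (simp only: inner_mult_transpose) (simp add: inner_axis)
    then have "transpose ?L *v (transpose ?\<Lambda> *v fst \<omega>) = 0" unfolding vec_eq_iff zero_index by blast
    then have "transpose ?\<Lambda> *v fst \<omega> = 0"
      using mult_vec_matrix_inv(2)[of "transpose ?L"] det_tilt_root[OF qr a(1) at[OF t(1)]]
      by (metis det_transpose matrix_vector_mult_0_right)
    then have "fst \<omega> = 0"
      using mult_vec_matrix_inv(2)[of "transpose ?\<Lambda>"] pos_def_det_nonzero[OF pos_def_matrix_inv[OF \<Sigma>]]
      by (metis det_transpose matrix_vector_mult_0_right)
    then show False using prior_on_space(2)[OF G \<omega>] by simp
  qed
  have "AE \<omega> in G. False" using all0 by (rule AE_mp) (intro AE_I2 impI, rule no)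
  moreover have "prob_space G" using G by (simp add: prior_on_def)
  ultimately show False by (simp add: prob_space.AE_False)
qed

text \<open>Both statistics fit the core lemma with \<open>r\<close> the last coordinate. The
  dimension bound supplies the second coordinate \<open>q\<close> that the construction
  needs.\<close>

theorem theorem2p1:
  fixes \<alpha> u :: real
  assumes "2 \<le> CARD('p::{finite,linorder})"
    and "CARD('p) < CARD('n::finite)"
    and "0 < \<alpha>" and "\<alpha> < 1" and "0 < u"
  shows "(has_size {X :: real^('p::{finite,linorder})^'n. uit_orthant X > u} \<alpha> \<longrightarrow>
            \<not> bayes_test orthant {X :: real^('p::{finite,linorder})^'n. uit_orthant X > u}) \<and>
         (has_size {X :: real^('p::{finite,linorder})^'n. uit_halfspace X > u} \<alpha> \<longrightarrow>
            \<not> bayes_test halfspace {X :: real^('p::{finite,linorder})^'n. uit_halfspace X > u})"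
proof -
  let ?r = "Max (UNIV :: 'p set)"
  have "\<exists>q. q \<noteq> ?r"
  proof (rule ccontr)
    assume "\<not> (\<exists>q. q \<noteq> ?r)"
    then have "(UNIV :: 'p set) = {?r}" by auto
    then have "CARD('p) = 1" by (metis card_1_singleton_iff One_nat_def)
    then show False using assms(1) by simp
  qed
  then obtain q where q: "q \<noteq> ?r" by blast
  have n: "1 < CARD('n)" using assms(1,2) by linarith
  have "\<not> bayes_test orthant {X :: real^('p::{finite,linorder})^'n. uit_orthant X > u}"
    by (rule not_bayes_test[OF assms(2) q assms(5)])
      (auto intro!: uit_orthant_interior[OF n] uit_orthant_facet[OF n])
  moreover have "\<not> bayes_test halfspace {X :: real^('p::{finite,linorder})^'n. uit_halfspace X > u}"
    by (rule not_bayes_test[OF assms(2) q assms(5)])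
      (auto intro!: uit_halfspace_interior uit_halfspace_facet[OF n])
  ultimately show ?thesis by blast
qed

end
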